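(* Let $V$ be a finite-dimensional vector space over a field $K$, let $q\in K\setminus\{0\}$ be not a root of unity, and let $\hat R$ be a Yang-Baxter matrix of Hecke type on $V\otimes V$ with eigenvalues $q$ and $-q^{-1}$. Let $T=(T^i_j)$ be the matrix of generators of the RTT-algebra of $\hat R$. For $k\ge1$ define $$T^{\underline{[k]}}:=\mathrm{Tr}_{(1\dots k-1)}(A_kT_1\cdots T_k),\qquad T^{\overline{[k]}}:=\mathrm{Tr}_{(2\dots k)}(A_kT_1\cdots T_k),$$ $$T^{\underline{k}}:=\mathrm{Tr}_{(1\dots k-1)}(\hat R_1\hat R_2\cdots\hat R_{k-1}T_1T_2\cdots T_k),\qquad T^{\overline{k}}:=\mathrm{Tr}_{(2\dots k)}(\hat R_1\hat R_2\cdots\hat R_{k-1}T_1T_2\cdots T_k),$$ $$\sigma_k(T):=q^k\,\mathrm{Tr}_{(1\dots k)}(A_kT_1\cdots T_k),\qquad \sigma_0(T):=1.$$ Then for all integers $k\ge1$ $$k_q\,T^{\underline{[k]}}=-\sum_{j=0}^{k-1}(-1)^{k-j}\,\sigma_j(T)\,T^{\underline{k-j}}$$ and $$k_q\,T^{\overline{[k]}}=-\sum_{j=0}^{k-1}(-1)^{k-j}\,T^{\overline{k-j}}\,\sigma_j(T).$$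
   Context: A Yang-Baxter matrix is an invertible operator $\hat R$ on $V\otimes V$ with $\hat R_1\hat R_2\hat R_1=\hat R_2\hat R_1\hat R_2$ on $V^{\otimes3}$, where $\hat R_i$ denotes $\hat R$ acting in the $i$-th and $(i+1)$-st copies of $V$. It is of Hecke type (with parameter $q$) if $(\hat R-q)(\hat R+q^{-1})=0$; no condition is imposed on the ranks of the two spectral projectors. $q$-numbers: $k_q:=(q^k-q^{-k})/(q-q^{-1})$. Antisymmetrizers $A_k$ on $V^{\otimes k}$ are defined inductively by $A_1:=I$ and $$A_k:=\frac1{k_q}A_{k-1}\bigl(q^{k-1}-(k-1)_q\hat R_{k-1}\bigr)A_{k-1},$$ where $A_{k-1}$ acts in the copies $1,\dots,k-1$. The RTT-algebra of $\hat R$ is the unital associative $K$-algebra generated by the entries $T^i_j$ ($1\le i,j\le\dim V$) of a matrix $T$ subject to $\hat RT_1T_2=T_1T_2\hat R$. Here $T_i$ is the matrix $T$ acting in the $i$-th copy of $V$ (with entries in the algebra, multiplied in the order written). $\mathrm{Tr}_{(a\dots b)}$ is the partial trace over copies $a,\dots,b$ of $V$, no trace being taken when $a>b$ (so $T^{\underline{1}}=T^{\overline{1}}=T^{\underline{[1]}}=T^{\overline{[1]}}=T$). After taking the trace, the remaining matrices are regarded as matrices on the single remaining copy of $V$ with entries in the algebra. *)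

theory Defs
  imports
    "HOL-Analysis.Analysis"
    "HOL-Algebra.QuotRing"
    "HOL-Algebra.Algebraic_Closure_Type"
    "HOL-Library.Poly_Mapping"
begin

unbundle no fps_syntax

text \<open>The free monoid on \<open>'x\<close>, written additively because multiplication of
  \<open>poly_mapping\<close> is convolution over \<open>monoid_add\<close>. Hence \<open>'x fmonoid \<Rightarrow>\<^sub>0 'k\<close> is the free
  unital associative \<open>'k\<close>-algebra on \<open>'x\<close>.\<close>

datatype 'x fmonoid = Word (letters: "'x list")

instantiation fmonoid :: (type) monoid_add
begin

definition zero_fmonoid :: "'a fmonoid" where
  "0 = Word []"

definition plus_fmonoid :: "'a fmonoid \<Rightarrow> 'a fmonoid \<Rightarrow> 'a fmonoid" where
  "v + w = Word (letters v @ letters w)"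

instance
  by standard (auto simp: zero_fmonoid_def plus_fmonoid_def)

end

type_synonym ('x, 'k) free_algebra = "'x fmonoid \<Rightarrow>\<^sub>0 'k"

definition free_gen :: "'x \<Rightarrow> ('x, 'k::zero_neq_one) free_algebra" where
  "free_gen x = Poly_Mapping.single (Word [x]) 1"

definition free_scalar :: "'k::zero \<Rightarrow> ('x, 'k) free_algebra" where
  "free_scalar c = Poly_Mapping.single 0 c"


section \<open>Matrices on tensor powers\<close>

text \<open>\<open>V\<close> has a basis indexed by the finite type \<open>'n\<close>. A matrix on \<open>V^{\<otimes>k}\<close> with entries in
  a ring \<open>S\<close> is a function of two multi-indices (row, column), of which only the values on
  lists of length \<open>k\<close> matter. Copies of \<open>V\<close> are numbered from 1.\<close>

type_synonym ('n, 'a) tmat = "'n list \<Rightarrow> 'n list \<Rightarrow> 'a"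

definition multi_indices :: "nat \<Rightarrow> 'n list set" where
  "multi_indices k = {w. length w = k}"

definition tone :: "('a, 'm) ring_scheme \<Rightarrow> ('n, 'a) tmat" where
  "tone S = (\<lambda>a b. if a = b then \<one>\<^bsub>S\<^esub> else \<zero>\<^bsub>S\<^esub>)"

definition tmult ::
  "('a, 'm) ring_scheme \<Rightarrow> nat \<Rightarrow> ('n, 'a) tmat \<Rightarrow> ('n, 'a) tmat \<Rightarrow> ('n, 'a) tmat" where
  "tmult S k M N = (\<lambda>a b. \<Oplus>\<^bsub>S\<^esub>c\<in>multi_indices k. M a c \<otimes>\<^bsub>S\<^esub> N c b)"

definition tprod :: "('a, 'm) ring_scheme \<Rightarrow> nat \<Rightarrow> ('n, 'a) tmat list \<Rightarrow> ('n, 'a) tmat" where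
  "tprod S k Ms = foldr (tmult S k) Ms (tone S)"

text \<open>A matrix \<open>M\<close> on \<open>V^{\<otimes>m}\<close>, acting in the copies \<open>i, \<dots>, i + m - 1\<close> of a larger tensor power.\<close>

definition acting_at :: "('a, 'm) ring_scheme \<Rightarrow> nat \<Rightarrow> nat \<Rightarrow> ('n, 'a) tmat \<Rightarrow> ('n, 'a) tmat" where
  "acting_at S i m M = (\<lambda>a b.
     if take (i - 1) a = take (i - 1) b \<and> drop (i - 1 + m) a = drop (i - 1 + m) b
     then M (take m (drop (i - 1) a)) (take m (drop (i - 1) b)) else \<zero>\<^bsub>S\<^esub>)"

text \<open>Partial trace over the copies \<open>i, \<dots>, j\<close>; for \<open>i = j + 1\<close> the only summation index is \<open>[]\<close>,
  so that no trace is taken.\<close>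

definition ptrace :: "('a, 'm) ring_scheme \<Rightarrow> nat \<Rightarrow> nat \<Rightarrow> ('n, 'a) tmat \<Rightarrow> ('n, 'a) tmat" where
  "ptrace S i j M = (\<lambda>a b. \<Oplus>\<^bsub>S\<^esub>c\<in>multi_indices (j + 1 - i).
     M (take (i - 1) a @ c @ drop (i - 1) a) (take (i - 1) b @ c @ drop (i - 1) b))"


section \<open>Yang-Baxter matrices of Hecke type and antisymmetrizers\<close>

text \<open>An operator on \<open>V \<otimes> V\<close> is given by its matrix: \<open>R $ (i, j) $ (k, l)\<close> is the coefficient of
  \<open>e_i \<otimes> e_j\<close> in the image of \<open>e_k \<otimes> e_l\<close>.\<close>

definition tmat_of :: "'k ^ ('n::finite \<times> 'n) ^ ('n \<times> 'n) \<Rightarrow> ('n, 'k) tmat" where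
  "tmat_of R = (\<lambda>a b. R $ (a ! 0, a ! 1) $ (b ! 0, b ! 1))"

definition R_at :: "'k::field ^ ('n::finite \<times> 'n) ^ ('n \<times> 'n) \<Rightarrow> nat \<Rightarrow> ('n, 'k) tmat" where
  "R_at R i = acting_at ring_of_type_algebra i 2 (tmat_of R)"

definition yang_baxter :: "'k::field ^ ('n::finite \<times> 'n) ^ ('n \<times> 'n) \<Rightarrow> bool" where
  "yang_baxter R \<longleftrightarrow> invertible R \<and>
     (\<forall>a\<in>multi_indices 3. \<forall>b\<in>multi_indices 3.
        tprod ring_of_type_algebra 3 [R_at R 1, R_at R 2, R_at R 1] a b =
        tprod ring_of_type_algebra 3 [R_at R 2, R_at R 1, R_at R 2] a b)"

definition hecke_type :: "'k::field \<Rightarrow> 'k ^ ('n::finite \<times> 'n) ^ ('n \<times> 'n) \<Rightarrow> bool" where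
  "hecke_type q R \<longleftrightarrow> (R - mat q) ** (R + mat (inverse q)) = 0"

definition qnum :: "'k::field \<Rightarrow> nat \<Rightarrow> 'k" where
  "qnum q k = (q ^ k - inverse q ^ k) / (q - inverse q)"

text \<open>The value at 0 is a convention that is never used.\<close>

fun antisymmetrizer :: "'k::field \<Rightarrow> 'k ^ ('n::finite \<times> 'n) ^ ('n \<times> 'n) \<Rightarrow> nat \<Rightarrow> ('n, 'k) tmat" where
  "antisymmetrizer q R 0 = tone ring_of_type_algebra"
| "antisymmetrizer q R (Suc 0) = tone ring_of_type_algebra"
| "antisymmetrizer q R (Suc (Suc k)) =
     (let A = acting_at ring_of_type_algebra 1 (k + 1) (antisymmetrizer q R (Suc k));
          B = (\<lambda>a b. q ^ (k + 1) * tone ring_of_type_algebra a b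
                     - qnum q (k + 1) * R_at R (k + 1) a b)
      in (\<lambda>a b. 1 / qnum q (k + 2) * tprod ring_of_type_algebra (k + 2) [A, B, A] a b))"


section \<open>The RTT-algebra\<close>

definition one_copy :: "('n \<Rightarrow> 'n \<Rightarrow> 'a) \<Rightarrow> ('n, 'a) tmat" where
  "one_copy M = (\<lambda>a b. M (a ! 0) (b ! 0))"

definition T_at :: "('a, 'm) ring_scheme \<Rightarrow> ('n \<Rightarrow> 'n \<Rightarrow> 'a) \<Rightarrow> nat \<Rightarrow> ('n, 'a) tmat" where
  "T_at S M i = acting_at S i 1 (one_copy M)"

text \<open>The generator \<open>free_gen (i, j)\<close> stands for the entry of \<open>T\<close> in row \<open>i\<close> and column \<open>j\<close>.\<close>

definition rtt_relations ::
  "'k::field ^ ('n::finite \<times> 'n) ^ ('n \<times> 'n) \<Rightarrow> ('n \<times> 'n, 'k) free_algebra set" where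
  "rtt_relations R =
     (let S = ring_of_type_algebra;
          R' = (\<lambda>a b. free_scalar (tmat_of R a b));
          T1 = T_at S (\<lambda>i j. free_gen (i, j)) 1;
          T2 = T_at S (\<lambda>i j. free_gen (i, j)) 2
      in {tprod S 2 [R', T1, T2] a b - tprod S 2 [T1, T2, R'] a b
            |a b. a \<in> multi_indices 2 \<and> b \<in> multi_indices 2})"

definition rtt_ideal ::
  "'k::field ^ ('n::finite \<times> 'n) ^ ('n \<times> 'n) \<Rightarrow> ('n \<times> 'n, 'k) free_algebra set" where
  "rtt_ideal R = Idl\<^bsub>ring_of_type_algebra\<^esub> (rtt_relations R)"

definition rtt_algebra ::
  "'k::field ^ ('n::finite \<times> 'n) ^ ('n \<times> 'n) \<Rightarrow> ('n \<times> 'n, 'k) free_algebra set ring" where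
  "rtt_algebra R = ring_of_type_algebra Quot rtt_ideal R"

text \<open>The structure map of the \<open>'k\<close>-algebra; scalar multiplication is multiplication by its values.\<close>

definition rtt_scalar ::
  "'k::field ^ ('n::finite \<times> 'n) ^ ('n \<times> 'n) \<Rightarrow> 'k \<Rightarrow> ('n \<times> 'n, 'k) free_algebra set" where
  "rtt_scalar R c = rtt_ideal R +>\<^bsub>ring_of_type_algebra\<^esub> free_scalar c"

definition rtt_T ::
  "'k::field ^ ('n::finite \<times> 'n) ^ ('n \<times> 'n) \<Rightarrow> 'n \<Rightarrow> 'n \<Rightarrow> ('n \<times> 'n, 'k) free_algebra set" where
  "rtt_T R i j = rtt_ideal R +>\<^bsub>ring_of_type_algebra\<^esub> free_gen (i, j)"

definition rtt_tmat :: "'k::field ^ ('n::finite \<times> 'n) ^ ('n \<times> 'n) \<Rightarrow> ('n, 'k) tmat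
    \<Rightarrow> ('n, ('n \<times> 'n, 'k) free_algebra set) tmat" where
  "rtt_tmat R M = (\<lambda>a b. rtt_scalar R (M a b))"


section \<open>Powers, wedge powers and elementary symmetric functions of \<open>T\<close>\<close>

definition T_list :: "'k::field ^ ('n::finite \<times> 'n) ^ ('n \<times> 'n) \<Rightarrow> nat
    \<Rightarrow> ('n, ('n \<times> 'n, 'k) free_algebra set) tmat list" where
  "T_list R k = map (T_at (rtt_algebra R) (rtt_T R)) [1..<k + 1]"

definition A_T :: "'k::field \<Rightarrow> 'k ^ ('n::finite \<times> 'n) ^ ('n \<times> 'n) \<Rightarrow> nat
    \<Rightarrow> ('n, ('n \<times> 'n, 'k) free_algebra set) tmat" where
  "A_T q R k = tprod (rtt_algebra R) k (rtt_tmat R (antisymmetrizer q R k) # T_list R k)"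

definition R_T :: "'k::field ^ ('n::finite \<times> 'n) ^ ('n \<times> 'n) \<Rightarrow> nat
    \<Rightarrow> ('n, ('n \<times> 'n, 'k) free_algebra set) tmat" where
  "R_T R k = tprod (rtt_algebra R) k (map (\<lambda>i. rtt_tmat R (R_at R i)) [1..<k] @ T_list R k)"

definition lower_wedge_power :: "'k::field \<Rightarrow> 'k ^ ('n::finite \<times> 'n) ^ ('n \<times> 'n) \<Rightarrow> nat
    \<Rightarrow> 'n \<Rightarrow> 'n \<Rightarrow> ('n \<times> 'n, 'k) free_algebra set" where
  "lower_wedge_power q R k i j = ptrace (rtt_algebra R) 1 (k - 1) (A_T q R k) [i] [j]"

definition upper_wedge_power :: "'k::field \<Rightarrow> 'k ^ ('n::finite \<times> 'n) ^ ('n \<times> 'n) \<Rightarrow> nat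
    \<Rightarrow> 'n \<Rightarrow> 'n \<Rightarrow> ('n \<times> 'n, 'k) free_algebra set" where
  "upper_wedge_power q R k i j = ptrace (rtt_algebra R) 2 k (A_T q R k) [i] [j]"

definition lower_power :: "'k::field ^ ('n::finite \<times> 'n) ^ ('n \<times> 'n) \<Rightarrow> nat
    \<Rightarrow> 'n \<Rightarrow> 'n \<Rightarrow> ('n \<times> 'n, 'k) free_algebra set" where
  "lower_power R k i j = ptrace (rtt_algebra R) 1 (k - 1) (R_T R k) [i] [j]"

definition upper_power :: "'k::field ^ ('n::finite \<times> 'n) ^ ('n \<times> 'n) \<Rightarrow> nat
    \<Rightarrow> 'n \<Rightarrow> 'n \<Rightarrow> ('n \<times> 'n, 'k) free_algebra set" where
  "upper_power R k i j = ptrace (rtt_algebra R) 2 k (R_T R k) [i] [j]"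

definition sigma_T :: "'k::field \<Rightarrow> 'k ^ ('n::finite \<times> 'n) ^ ('n \<times> 'n) \<Rightarrow> nat
    \<Rightarrow> ('n \<times> 'n, 'k) free_algebra set" where
  "sigma_T q R k = (if k = 0 then \<one>\<^bsub>rtt_algebra R\<^esub>
     else rtt_scalar R (q ^ k) \<otimes>\<^bsub>rtt_algebra R\<^esub> ptrace (rtt_algebra R) 1 k (A_T q R k) [] [])"

end

theory Submission
  imports Defs
begin

text \<open>The recursion \<open>m_q A_m = A_{m-1} (q^{m-1} - (m-1)_q R_{m-1}) A_{m-1}\<close> is inserted into
  \<open>F_m = Tr_{1..k-1} (A_m R_m \<cdots> R_{k-1} T_1 \<cdots> T_k)\<close>. The term with \<open>q^{m-1}\<close> factorizes over
  \<open>V^{\<otimes>(m-1)} \<otimes> V^{\<otimes>(k-m+1)}\<close> into \<open>\<sigma>_{m-1}\<close> times a power of \<open>T\<close>. In the other term one copy of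
  \<open>A_{m-1}\<close> commutes with \<open>R_m \<cdots> R_{k-1}\<close> and, by the RTT relations, with \<open>T_1 \<cdots> T_k\<close>; by cyclicity
  of the trace it is absorbed by the other copy, which leaves \<open>F_{m-1}\<close>. Unrolling this from \<open>m = k\<close>
  to \<open>m = 1\<close> gives the first identity. For the second one the traced copies lie on the right, so the
  mirrored recursion is needed, and with it the fact that it yields the same \<open>A_k\<close>.

  Entries are handled as elements of the free algebra, modulo the ideal of RTT relations.\<close>

section \<open>Antisymmetrizers in the Hecke algebra\<close>

text \<open>The entries of \<open>T\<close> do not commute, so a trace is cyclic only in factors
  with central entries, that is, in matrices coming from the field, and only if these act in traced
  copies. A projector must therefore pass the whole product T_1 ... T_k by the RTT relations before
  it can be carried around the trace. Under the trace over copies 1,...,k-1 this is open to A_m for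
  every m < k. Under the trace over 2,...,k it is not, since A_m with m >= 2 touches the untraced
  copy 1; a projector in the last m < k copies avoids it, which is why the recursion is mirrored.

  That both constructions end in the same A_k rests on R_i A_k = A_k R_i = -q^{-1} A_k for all i <
  k: on such an eigenvector each factor q^j - j_q R_j acts as the scalar q^j + q^{-1} j_q = (j+1)_q,
  which cancels the denominator of the recursion. Idempotence has the same source. The q-numbers may
  be divided by because q is not a root of unity.\<close>

locale scaled_ring =
  fixes scale :: "'k::field \<Rightarrow> 'm::ring \<Rightarrow> 'm"
  assumes scale_add_right: "scale c (x + y) = scale c x + scale c y"
    and scale_add_left: "scale (c + d) x = scale c x + scale d x"
    and scale_scale [simp]: "scale c (scale d x) = scale (c * d) x"
    and scale_one [simp]: "scale 1 x = x"
    and scale_mult_left [simp]: "scale c x * y = scale c (x * y)"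
    and scale_mult_right [simp]: "x * scale c y = scale c (x * y)"
begin

lemma scale_zero_right [simp]: "scale c 0 = 0"
  using scale_add_right[of c 0 0] by simp

lemma scale_zero_left [simp]: "scale 0 x = 0"
  using scale_add_left[of 0 0 x] by simp

lemma scale_minus_right [simp]: "scale c (- x) = - scale c x"
  by (rule minus_unique[symmetric]) (simp flip: scale_add_right)

lemma scale_minus_left [simp]: "scale (- c) x = - scale c x"
  by (rule minus_unique[symmetric]) (simp flip: scale_add_left)

lemma scale_diff_right: "scale c (x - y) = scale c x - scale c y"
  using scale_add_right[of c x "- y"] by simp

lemma scale_diff_left: "scale (c - d) x = scale c x - scale d x"
  using scale_add_left[of c "- d" x] by simp

text \<open>Unit and generators are parameters because the recursion is run on every tensor power
  and in both orders of the generators, and is carried between tensor powers by homomorphisms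
  mapping one unit to the other.\<close>

fun asym :: "'k \<Rightarrow> 'm \<Rightarrow> (nat \<Rightarrow> 'm) \<Rightarrow> nat \<Rightarrow> 'm" where
  "asym q e R 0 = e"
| "asym q e R (Suc 0) = e"
| "asym q e R (Suc (Suc m)) = scale (1 / qnum q (m + 2))
     (asym q e R (Suc m) * (scale (q ^ (m + 1)) e - scale (qnum q (m + 1)) (R (m + 1)))
        * asym q e R (Suc m))"

declare asym.simps(3) [simp del]

text \<open>Only generators with index below \<open>m\<close> enter the recursion. Commutation and
  centrality statements about antisymmetrizers are reduced to generators in this way.\<close>

lemma asym_induct:
  assumes "P e" and "\<And>i. 1 \<le> i \<Longrightarrow> i < m \<Longrightarrow> P (R i)"
    and "\<And>x y. P x \<Longrightarrow> P y \<Longrightarrow> P (x - y)" and "\<And>x y. P x \<Longrightarrow> P y \<Longrightarrow> P (x * y)"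
    and "\<And>c x. P x \<Longrightarrow> P (scale c x)"
  shows "P (asym q e R m)"
proof -
  have "j \<le> m \<Longrightarrow> P (asym q e R j)" for j
  proof (induction j rule: less_induct)
    case (less j)
    consider "j = 0" | "j = Suc 0" | l where "j = Suc (Suc l)"
      by (metis not0_implies_Suc)
    then show ?case
      by cases (use less in \<open>auto simp: asym.simps(3) intro!: assms\<close>)
  qed
  then show ?thesis by blast
qed

lemma asym_hom:
  assumes "f e = e'" and "\<And>i. 1 \<le> i \<Longrightarrow> i < m \<Longrightarrow> f (R i) = R' i"
    and "\<And>x y. f (x - y) = f x - f y" and "\<And>x y. f (x * y) = f x * f y"
    and "\<And>c x. f (scale c x) = scale c (f x)"
  shows "f (asym q e R m) = asym q e' R' m"
proof -
  have "j \<le> m \<Longrightarrow> f (asym q e R j) = asym q e' R' j" for j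
  proof (induction j rule: less_induct)
    case (less j)
    consider "j = 0" | "j = Suc 0" | l where "j = Suc (Suc l)"
      by (metis not0_implies_Suc)
    then show ?case
      by cases (use less in \<open>auto simp: asym.simps(3) assms\<close>)
  qed
  then show ?thesis by blast
qed

end

section \<open>q-numbers for q not a root of unity\<close>

locale q_generic =
  fixes q :: "'k::field"
  assumes q_nonzero: "q \<noteq> 0" and not_root_of_unity: "\<forall>m>0. q ^ m \<noteq> 1"
begin

lemma q_diff_inverse_nonzero: "q - inverse q \<noteq> 0"
proof
  assume "q - inverse q = 0"
  then have "q ^ 2 = 1"
    using q_nonzero by (simp add: field_simps power2_eq_square)
  then show False using not_root_of_unity by (metis pos2)
qed

lemma qnum_nonzero:
  assumes "m > 0"
  shows "qnum q m \<noteq> 0"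
proof
  assume "qnum q m = 0"
  then have "q ^ m = inverse q ^ m"
    using q_diff_inverse_nonzero by (simp add: qnum_def)
  then have "q ^ (m + m) = 1"
    using q_nonzero by (simp add: power_add field_simps)
  then show False using not_root_of_unity assms by (metis add_gr_0)
qed

lemma qnum_one [simp]: "qnum q (Suc 0) = 1"
  using q_diff_inverse_nonzero by (simp add: qnum_def)

text \<open>This is the value of q^m - m_q R_m on an eigenvector of R_m with eigenvalue
  -q^{-1}.\<close>

lemma qnum_Suc: "qnum q (Suc m) = q ^ m + inverse q * qnum q m"
proof -
  have "q ^ Suc m - inverse q ^ Suc m
      = q ^ m * (q - inverse q) + inverse q * (q ^ m - inverse q ^ m)"
    by (simp add: algebra_simps)
  then show ?thesis
    using q_diff_inverse_nonzero by (simp add: qnum_def add_divide_distrib)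
qed

end

text \<open>\<open>e\<close> stands for the identity of one tensor power, which is an idempotent but
  not the unit of the ring of all tensor powers; hence the explicit unit laws. The bound
  \<open>n\<close> restricts the relations to R_1,...,R_{n-1}, the generators present on the n-th
  tensor power.\<close>

locale hecke = scaled_ring scale + q_generic q
  for scale :: "'k::field \<Rightarrow> 'm::ring \<Rightarrow> 'm" and q :: 'k +
  fixes e :: 'm and R :: "nat \<Rightarrow> 'm" and n :: nat
  assumes unit_unit [simp]: "e * e = e"
    and unit_gen: "1 \<le> i \<Longrightarrow> i < n \<Longrightarrow> e * R i = R i"
    and gen_unit: "1 \<le> i \<Longrightarrow> i < n \<Longrightarrow> R i * e = R i"
    and quadratic: "1 \<le> i \<Longrightarrow> i < n \<Longrightarrow> (R i - scale q e) * (R i + scale (inverse q) e) = 0"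
    and braid: "1 \<le> i \<Longrightarrow> i + 1 < n \<Longrightarrow> R i * R (i + 1) * R i = R (i + 1) * R i * R (i + 1)"
    and far: "1 \<le> i \<Longrightarrow> i + 2 \<le> j \<Longrightarrow> j < n \<Longrightarrow> R i * R j = R j * R i"
begin

abbreviation A :: "nat \<Rightarrow> 'm" where "A \<equiv> asym q e R"

lemma gen_square:
  assumes "1 \<le> i" "i < n"
  shows "R i * R i = e + scale (q - inverse q) (R i)"
  using quadratic[OF assms] assms q_nonzero
  by (simp add: algebra_simps scale_add_right scale_diff_left scale_diff_right unit_gen gen_unit)

lemma unit_asym [simp]: "m \<le> n \<Longrightarrow> e * A m = A m"
  by (rule asym_induct[where P = "\<lambda>x. e * x = x"])
    (auto simp: unit_gen algebra_simps simp flip: mult.assoc)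

lemma asym_unit [simp]: "m \<le> n \<Longrightarrow> A m * e = A m"
  by (rule asym_induct[where P = "\<lambda>x. x * e = x"]) (auto simp: gen_unit algebra_simps)

lemma asym_far:
  assumes "m < j" "j < n"
  shows "A m * R j = R j * A m"
proof (rule asym_induct[where P = "\<lambda>x. x * R j = R j * x"])
  fix x y assume "x * R j = R j * x" "y * R j = R j * y"
  then show "x * y * R j = R j * (x * y)" by (metis mult.assoc)
qed (use assms far[of _ j] in \<open>auto simp: unit_gen gen_unit algebra_simps\<close>)

text \<open>Idempotence is an assumption because the expansion is used inside the induction that
  establishes it. It reduces \<open>A * e * A\<close> to \<open>A\<close>, and clearing the
  denominator keeps fractions out of the later computations.\<close>

lemma asym_Suc_Suc_expand:
  assumes "m + 2 \<le> n" "A (m + 1) * A (m + 1) = A (m + 1)"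
  shows "scale (qnum q (m + 2)) (A (m + 2))
    = scale (q ^ (m + 1)) (A (m + 1)) - scale (qnum q (m + 1)) (A (m + 1) * R (m + 1) * A (m + 1))"
  using assms qnum_nonzero[of "m + 2"] by (simp add: asym.simps(3) algebra_simps)

text \<open>In the next two lemmas \<open>b\<close>, \<open>a\<close> are consecutive antisymmetrizers and \<open>x\<close>, \<open>y\<close> consecutive
  generators. The braid relation is what reduces \<open>y * a * y * a\<close> to shorter words.\<close>

lemma gen_asym_step:
  assumes a: "scale c a = scale (q ^ m) b - scale d (b * x * b)"
    and ba: "b * a = a" and comm: "b * y = y * b" 
    and yxy: "y * x * y = x * y * x" and xa: "x * a = scale (- inverse q) a" 
    and yy: "y * y = e + scale (q - inverse q) y" and ea: "e * a = a"
  shows "scale c (y * a * y * a)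
    = scale (q ^ m) a + scale (q ^ (m + 1)) (y * a) - scale (inverse q * c) (a * y * a)"
proof -
  have bya: "b * (y * a) = y * a" by (metis ba comm mult.assoc)
  have yya: "y * (y * a) = a + scale (q - inverse q) (y * a)"
    by (simp add: ea distrib_right yy flip: mult.assoc)
  have "scale c (a * y * a) = scale c a * (y * a)" by (simp add: mult.assoc)
  also have "\<dots> = scale (q ^ m) (y * a) - scale d (b * (x * (y * a)))"
    by (simp add: a left_diff_distrib mult.assoc bya)
  finally have aya: "scale d (b * (x * (y * a))) = scale (q ^ m) (y * a) - scale c (a * y * a)"
    by simp
  have "y * (b * (x * (y * a))) = b * (y * x * y * a)"
    by (metis comm mult.assoc)
  also have "\<dots> = b * (x * y * (x * a))"
    unfolding yxy by (simp add: mult.assoc)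
  also have "\<dots> = - scale (inverse q) (b * (x * (y * a)))"
    by (simp add: xa mult.assoc)
  finally have yb: "y * (b * (x * (y * a))) = - scale (inverse q) (b * (x * (y * a)))" .
  have "scale c (y * a * y * a) = y * (scale c a * (y * a))" by (simp add: mult.assoc)
  also have "\<dots> = scale (q ^ m) (y * (y * a)) - scale d (y * (b * (x * (y * a))))"
    by (simp add: a left_diff_distrib right_diff_distrib mult.assoc bya)
  also have "\<dots> = scale (q ^ m) (a + scale (q - inverse q) (y * a))
      + scale (inverse q) (scale d (b * (x * (y * a))))"
    by (simp add: yya yb mult.commute)
  also have "\<dots> = scale (q ^ m) a + scale (q ^ (m + 1)) (y * a) - scale (inverse q * c) (a * y * a)"
    unfolding aya by (simp add: scale_add_right scale_diff_right scale_diff_left algebra_simps)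
  finally show ?thesis .
qed

lemma asym_gen_step:
  assumes a: "scale c a = scale (q ^ m) b - scale d (b * x * b)"
    and ab: "a * b = a" and comm: "b * y = y * b" 
    and yxy: "y * x * y = x * y * x" and ax: "a * x = scale (- inverse q) a" 
    and yy: "y * y = e + scale (q - inverse q) y" and ae: "a * e = a"
  shows "scale c (a * y * a * y)
    = scale (q ^ m) a + scale (q ^ (m + 1)) (a * y) - scale (inverse q * c) (a * y * a)"
proof -
  have ayb: "a * y * b = a * y" by (metis ab comm mult.assoc)
  have ayy: "a * y * y = a + scale (q - inverse q) (a * y)"
    by (simp add: ae distrib_left yy mult.assoc)
  have "scale c (a * y * a) = a * y * scale c a" by simp
  also have "\<dots> = scale (q ^ m) (a * y) - scale d (a * y * x * b)"
    by (simp add: a right_diff_distrib ayb flip: mult.assoc)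
  finally have aya: "scale d (a * y * x * b) = scale (q ^ m) (a * y) - scale c (a * y * a)"
    by simp
  have "a * y * x * b * y = a * (y * x * y) * b"
    by (metis comm mult.assoc)
  also have "\<dots> = a * x * y * x * b"
    unfolding yxy by (simp add: mult.assoc)
  also have "\<dots> = - scale (inverse q) (a * y * x * b)"
    by (simp add: ax)
  finally have yb: "a * y * x * b * y = - scale (inverse q) (a * y * x * b)" .
  have "scale c (a * y * a * y) = a * y * scale c a * y" by simp
  also have "\<dots> = scale (q ^ m) (a * y * y) - scale d (a * y * x * b * y)"
    by (simp add: a left_diff_distrib right_diff_distrib ayb flip: mult.assoc)
  also have "\<dots> = scale (q ^ m) (a + scale (q - inverse q) (a * y))
      + scale (inverse q) (scale d (a * y * x * b))"
    by (simp add: ayy yb mult.commute)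
  also have "\<dots> = scale (q ^ m) a + scale (q ^ (m + 1)) (a * y) - scale (inverse q * c) (a * y * a)"
    unfolding aya by (simp add: scale_add_right scale_diff_right scale_diff_left algebra_simps)
  finally show ?thesis .
qed

lemma scale_cancel: "c \<noteq> 0 \<Longrightarrow> scale c x = scale c y \<longleftrightarrow> x = y"
  by (metis nonzero_divide_eq_eq scale_one scale_scale)

text \<open>The claims need a joint induction: the eigenvalue of R_m on A_{m+1} is computed from the
  eigenvalue, idempotence and absorption one level lower, and it in turn gives idempotence of
  A_{m+1}.\<close>

lemma asym_relations:
  assumes "m + 1 \<le> n"
  shows "A (m + 1) * A (m + 1) = A (m + 1) \<and>
    (m \<ge> 1 \<longrightarrow> A m * A m = A m \<and> R m * A (m + 1) = scale (- inverse q) (A (m + 1)) \<and>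
      A (m + 1) * R m = scale (- inverse q) (A (m + 1)) \<and>
      A m * A (m + 1) = A (m + 1) \<and> A (m + 1) * A m = A (m + 1))"
  using assms
proof (induction m)
  case 0
  then show ?case by simp
next
  case (Suc m)
  let ?a = "A (m + 1)" and ?y = "R (m + 1)" and ?C = "A (m + 2)"
  have IH': "?a * ?a = ?a" and m: "m + 2 \<le> n" using Suc by auto
  note ex = asym_Suc_Suc_expand[OF m IH']
  have nz: "qnum q (m + 2) \<noteq> 0" "qnum q (m + 1) \<noteq> 0"
    using qnum_nonzero by auto
  have aC: "?a * ?C = ?C"
    by (simp add: asym.simps(3) mult.assoc[symmetric] IH'[simplified])
  have Ca: "?C * ?a = ?C"
    by (simp add: asym.simps(3) mult.assoc IH'[simplified])
  have step: "scale (qnum q (m + 1)) (?y * ?a * ?y * ?a)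
      = scale (q ^ m) ?a + scale (q ^ (m + 1)) (?y * ?a) - scale (inverse q * qnum q (m + 1)) (?a * ?y * ?a)
     \<and> scale (qnum q (m + 1)) (?a * ?y * ?a * ?y)
      = scale (q ^ m) ?a + scale (q ^ (m + 1)) (?a * ?y) - scale (inverse q * qnum q (m + 1)) (?a * ?y * ?a)"
  proof (cases m)
    case 0
    \<comment> \<open>Here \<open>?a\<close> is \<open>e\<close>, and both formulas are the
      quadratic relation for the first generator.\<close>
    then show ?thesis using m q_nonzero
      by (simp add: unit_gen gen_unit gen_square scale_diff_left scale_add_left algebra_simps)
  next
    case (Suc l)
    let ?b = "A m" and ?x = "R m"
    have bb: "?b * ?b = ?b" and ba: "?b * ?a = ?a" and ab: "?a * ?b = ?a"
      and xa: "?x * ?a = scale (- inverse q) ?a" and ax: "?a * ?x = scale (- inverse q) ?a"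
      using Suc Suc.prems Suc.IH IH' by auto
    have ex': "scale (qnum q (m + 1)) ?a = scale (q ^ m) ?b - scale (qnum q m) (?b * ?x * ?b)"
      using asym_Suc_Suc_expand[of l] Suc bb m by simp
    have comm: "?b * ?y = ?y * ?b" using asym_far[of m "m + 1"] m by simp
    have yxy: "?y * ?x * ?y = ?x * ?y * ?x" using braid[of m] Suc m by simp
    have yy: "?y * ?y = e + scale (q - inverse q) ?y" using gen_square[of "m + 1"] m by simp
    have e: "e * ?a = ?a" "?a * e = ?a" using m by auto
    show ?thesis
      using gen_asym_step[OF ex' ba comm yxy xa yy e(1)]
        asym_gen_step[OF ex' ab comm yxy ax yy e(2)] by simp
  qed
  have coeff [simp]: "q * (inverse q * z) = z" for z
    using q_nonzero by simp
  \<comment> \<open>Inserting \<open>step\<close> cancels the two terms in \<open>?y * ?a\<close>;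
    what is left is -q^{-1} times the expansion \<open>ex\<close> of \<open>?C\<close>.\<close>
  have "scale (qnum q (m + 2)) (?y * ?C) = scale (q ^ (m + 1)) (?y * ?a)
      - scale (qnum q (m + 1)) (?y * ?a * ?y * ?a)"
    using arg_cong[OF ex, of "\<lambda>z. ?y * z"] by (simp add: right_diff_distrib mult.assoc)
  also have "\<dots> = scale (- inverse q) (scale (qnum q (m + 2)) ?C)"
    unfolding ex step[THEN conjunct1]
    by (simp add: scale_diff_right algebra_simps)
  finally have yC: "?y * ?C = scale (- inverse q) ?C"
    by (subst scale_cancel[OF nz(1), symmetric]) (simp add: mult.commute)
  have "scale (qnum q (m + 2)) (?C * ?y) = scale (q ^ (m + 1)) (?a * ?y)
      - scale (qnum q (m + 1)) (?a * ?y * ?a * ?y)"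
    using arg_cong[OF ex, of "\<lambda>z. z * ?y"] by (simp add: left_diff_distrib mult.assoc)
  also have "\<dots> = scale (- inverse q) (scale (qnum q (m + 2)) ?C)"
    unfolding ex step[THEN conjunct2]
    by (simp add: scale_diff_right algebra_simps)
  finally have Cy: "?C * ?y = scale (- inverse q) ?C"
    by (subst scale_cancel[OF nz(1), symmetric]) (simp add: mult.commute)
  \<comment> \<open>\<open>?C\<close> absorbs \<open>?a\<close> and \<open>?y\<close> acts on it as
    -q^{-1}, so the coefficient becomes q^{m+1} + q^{-1} (m+1)_q = (m+2)_q.\<close>
  have "scale (qnum q (m + 2)) (?C * ?C) = scale (q ^ (m + 1)) (?a * ?C)
      - scale (qnum q (m + 1)) (?a * ?y * ?a * ?C)"
    using arg_cong[OF ex, of "\<lambda>z. z * ?C"] by (simp add: left_diff_distrib mult.assoc)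
  also have "\<dots> = scale (qnum q (m + 2)) ?C"
    using qnum_Suc[of "m + 1"]
    by (simp add: mult.assoc aC[simplified] yC[simplified] scale_add_left algebra_simps)
  finally have CC: "?C * ?C = ?C"
    using scale_cancel[OF nz(1)] by simp
  show ?case using CC yC Cy aC Ca IH' by simp
qed

text \<open>The previous lemma covers only the last generator. Writing A_{m+1} as A_m A_{m+1} or
  A_{m+1} A_m exposes the smaller antisymmetrizer to the earlier ones.\<close>

lemma gen_asym_all:
  assumes "1 \<le> i" "i < m" "m \<le> n"
  shows "R i * A m = scale (- inverse q) (A m)" "A m * R i = scale (- inverse q) (A m)"
proof -
  have "R i * A m = scale (- inverse q) (A m) \<and> A m * R i = scale (- inverse q) (A m)"
    using assms(2,3)
  proof (induction m)
    case (Suc m)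
    have rel: "A m * A (Suc m) = A (Suc m)" "A (Suc m) * A m = A (Suc m)"
      using asym_relations[of m] Suc assms(1) by auto
    show ?case
    proof (cases "i = m")
      case True
      then show ?thesis using asym_relations[of m] Suc assms(1) by simp
    next
      case False
      then have IH: "R i * A m = scale (- inverse q) (A m)" "A m * R i = scale (- inverse q) (A m)"
        using Suc by auto
      have "R i * A (Suc m) = R i * A m * A (Suc m)" "A (Suc m) * R i = A (Suc m) * (A m * R i)"
        by (metis mult.assoc rel)+
      then show ?thesis by (simp add: IH rel)
    qed
  qed simp
  then show "R i * A m = scale (- inverse q) (A m)" "A m * R i = scale (- inverse q) (A m)"
    by auto
qed

lemma asym_idem: "m \<le> n \<Longrightarrow> A m * A m = A m"
  using asym_relations[of "m - 1"] by (cases m) auto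

text \<open>Every factor of the recursion multiplies \<open>x\<close> by the q-number in the next
  denominator. No relations among the \<open>S i\<close> enter, so the ordinary and the reversed
  order of generators are both allowed.\<close>

lemma asym_absorb:
  assumes "\<And>i. 1 \<le> i \<Longrightarrow> i < m \<Longrightarrow> S i * x = scale (- inverse q) x" and "e * x = x"
  shows "asym q e S m * x = x"
proof -
  have "j \<le> m \<Longrightarrow> asym q e S j * x = x" for j
  proof (induction j rule: less_induct)
    case (less j)
    consider "j = 0" | "j = Suc 0" | l where "j = Suc (Suc l)"
      by (metis not0_implies_Suc)
    then show ?case
    proof cases
      case 3
      have "asym q e S (Suc l) * x = x" "S (Suc l) * x = scale (- inverse q) x"
        using less 3 assms by auto
      moreover have "qnum q (Suc (Suc l)) \<noteq> 0" by (rule qnum_nonzero) simp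
      ultimately show ?thesis
        unfolding 3 asym.simps using qnum_Suc[of "Suc l"]
        by (simp add: mult.assoc left_diff_distrib assms(2) flip: scale_add_left)
          (simp add: algebra_simps flip: scale_add_left)
    qed (use assms in auto)
  qed
  then show ?thesis by blast
qed

lemma absorb_asym:
  assumes "\<And>i. 1 \<le> i \<Longrightarrow> i < m \<Longrightarrow> x * S i = scale (- inverse q) x" and "x * e = x"
  shows "x * asym q e S m = x"
proof -
  have "j \<le> m \<Longrightarrow> x * asym q e S j = x" for j
  proof (induction j rule: less_induct)
    case (less j)
    consider "j = 0" | "j = Suc 0" | l where "j = Suc (Suc l)"
      by (metis not0_implies_Suc)
    then show ?case
    proof cases
      case 3
      have "x * asym q e S (Suc l) = x" "x * S (Suc l) = scale (- inverse q) x"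
        using less 3 assms by auto
      moreover have "qnum q (Suc (Suc l)) \<noteq> 0" by (rule qnum_nonzero) simp
      ultimately show ?thesis
        unfolding 3 asym.simps using qnum_Suc[of "Suc l"]
        by (simp add: mult.assoc[symmetric] right_diff_distrib assms(2) flip: scale_add_left)
          (simp add: algebra_simps flip: scale_add_left)
    qed (use assms in auto)
  qed
  then show ?thesis by blast
qed

text \<open>The relations are symmetric under reflecting the index set 1,...,n-1, so all results on
  antisymmetrizers also hold for the mirrored recursion.\<close>

lemma hecke_reverse: "hecke scale q e (\<lambda>i. R (n - i)) n"
proof unfold_locales
  fix i assume "1 \<le> i" "i + 1 < n"
  then show "R (n - i) * R (n - (i + 1)) * R (n - i) = R (n - (i + 1)) * R (n - i) * R (n - (i + 1))"
    using braid[of "n - (i + 1)"] by (simp add: Suc_diff_Suc)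
next
  fix i j assume "1 \<le> i" "i + 2 \<le> j" "j < n"
  then show "R (n - i) * R (n - j) = R (n - j) * R (n - i)"
    using far[of "n - j" "n - i"] by simp
qed (use quadratic unit_gen gen_unit in auto)

text \<open>The antisymmetrizers built from the left and from the right are absorbed by each other on
  opposite sides, so they coincide.\<close>

lemma asym_reverse: "asym q e (\<lambda>i. R (n - i)) n = A n"
proof -
  interpret rev: hecke scale q e "\<lambda>i. R (n - i)" n by (rule hecke_reverse)
  have "A n * asym q e (\<lambda>i. R (n - i)) n = asym q e (\<lambda>i. R (n - i)) n"
  proof (rule asym_absorb)
    fix i assume "1 \<le> i" "i < n"
    then show "R i * rev.A n = scale (- inverse q) (rev.A n)"
      using rev.gen_asym_all(1)[of "n - i" n] by simp
  qed simp
  moreover have "A n * asym q e (\<lambda>i. R (n - i)) n = A n"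
  proof (rule absorb_asym)
    fix i assume "1 \<le> i" "i < n"
    then show "A n * R (n - i) = scale (- inverse q) (A n)"
      using gen_asym_all(2)[of "n - i" n] by simp
  qed simp
  ultimately show ?thesis by simp
qed

end


section \<open>Matrices on all tensor powers\<close>

lemma finite_multi_indices [simp, intro]: "finite (multi_indices k :: 'n::finite list set)"
  using finite_lists_length_eq[of "UNIV :: 'n set" k] by (simp add: multi_indices_def)

lemma in_multi_indices [simp]: "w \<in> multi_indices k \<longleftrightarrow> length w = k"
  by (simp add: multi_indices_def)

lemma multi_indices_0 [simp]: "multi_indices 0 = {[]}"
  by (auto simp: multi_indices_def)

lemma sum_multi_indices_add:
  fixes g :: "'n::finite list \<Rightarrow> 'a::comm_monoid_add"
  shows "(\<Sum>c\<in>multi_indices (p + m). g c)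
    = (\<Sum>c\<in>multi_indices p. \<Sum>d\<in>multi_indices m. g (c @ d))"
proof -
  have "(\<Sum>c\<in>multi_indices (p + m). g c)
      = (\<Sum>(c, d)\<in>multi_indices p \<times> multi_indices m. g (c @ d))"
    by (rule sum.reindex_bij_witness[of _ "\<lambda>(c, d). c @ d" "\<lambda>c. (take p c, drop p c)"]) auto
  then show ?thesis by (simp add: sum.cartesian_product)
qed

lemma sum_multi_indices_1:
  fixes g :: "'n::finite list \<Rightarrow> 'a::comm_monoid_add"
  shows "(\<Sum>c\<in>multi_indices (Suc 0). g c) = (\<Sum>i\<in>UNIV. g [i])"
  by (rule sum.reindex_bij_witness[of _ "\<lambda>i. [i]" hd]) (auto simp: length_Suc_conv)

lemma sum_multi_indices_Suc:
  fixes g :: "'n::finite list \<Rightarrow> 'a::comm_monoid_add"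
  shows "(\<Sum>c\<in>multi_indices (Suc m). g c) = (\<Sum>i\<in>UNIV. \<Sum>d\<in>multi_indices m. g (i # d))"
  using sum_multi_indices_add[of g "Suc 0" m] by (simp add: sum_multi_indices_1)

text \<open>An element is a family of matrices, one on each \<open>V^{\<otimes>n}\<close>, so that a single type serves all
  tensor powers. A matrix on a fixed \<open>V^{\<otimes>n}\<close> is embedded by zero on words of other lengths; the
  identity of \<open>V^{\<otimes>n}\<close> then becomes the idempotent \<open>unit_bmat n\<close>.\<close>

typedef (overloaded) ('n, 'a) bmat =
  "{M :: ('n, 'a::zero) tmat. \<forall>a b. length a \<noteq> length b \<longrightarrow> M a b = 0}"
  morphisms entry Abs_bmat by auto

definition mk_bmat :: "('n, 'a::zero) tmat \<Rightarrow> ('n, 'a) bmat" where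
  "mk_bmat f = Abs_bmat (\<lambda>a b. if length a = length b then f a b else 0)"

lemma entry_mk_bmat [simp]:
  "entry (mk_bmat f) a b = (if length a = length b then f a b else 0)"
  by (simp add: mk_bmat_def Abs_bmat_inverse)

lemma entry_eq_0: "length a \<noteq> length b \<Longrightarrow> entry M a b = 0"
  using entry[of M] by simp

lemma bmat_eqI:
  "(\<And>a b. length a = length b \<Longrightarrow> entry M a b = entry N a b) \<Longrightarrow> M = N"
  by (intro entry_inject[THEN iffD1] ext) (metis entry_eq_0)

instantiation bmat :: (finite, ring) ring
begin

definition zero_bmat :: "('a, 'b) bmat" where "0 = mk_bmat (\<lambda>a b. 0)"
definition plus_bmat :: "('a, 'b) bmat \<Rightarrow> ('a, 'b) bmat \<Rightarrow> ('a, 'b) bmat" where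
  "M + N = mk_bmat (\<lambda>a b. entry M a b + entry N a b)"
definition minus_bmat :: "('a, 'b) bmat \<Rightarrow> ('a, 'b) bmat \<Rightarrow> ('a, 'b) bmat" where
  "M - N = mk_bmat (\<lambda>a b. entry M a b - entry N a b)"
definition uminus_bmat :: "('a, 'b) bmat \<Rightarrow> ('a, 'b) bmat" where
  "- M = mk_bmat (\<lambda>a b. - entry M a b)"
definition times_bmat :: "('a, 'b) bmat \<Rightarrow> ('a, 'b) bmat \<Rightarrow> ('a, 'b) bmat" where
  "M * N = mk_bmat (\<lambda>a b. \<Sum>c\<in>multi_indices (length a). entry M a c * entry N c b)"

lemma entry_zero [simp]: "entry (0 :: ('a, 'b) bmat) a b = 0"
  and entry_plus [simp]: "entry (M + N) a b = entry M a b + entry N a b"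
  and entry_minus [simp]: "entry (M - N) a b = entry M a b - entry N a b"
  and entry_uminus [simp]: "entry (- M) a b = - entry M a b"
  by (auto simp: zero_bmat_def plus_bmat_def minus_bmat_def uminus_bmat_def entry_eq_0)

lemma entry_times:
  "entry (M * N) a b = (\<Sum>c\<in>multi_indices (length a). entry M a c * entry N c b)"
  by (cases "length a = length b") (auto simp: times_bmat_def entry_eq_0)

instance
proof
  fix M N P :: "('a, 'b) bmat"
  show "M * N * P = M * (N * P)"
  proof (rule bmat_eqI)
    fix a b :: "'a list"
    have "entry (M * N * P) a b = (\<Sum>c\<in>multi_indices (length a). \<Sum>d\<in>multi_indices (length a).
        entry M a d * entry N d c * entry P c b)"
      by (simp add: entry_times sum_distrib_right)
    also have "\<dots> = (\<Sum>d\<in>multi_indices (length a). \<Sum>c\<in>multi_indices (length a).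
        entry M a d * entry N d c * entry P c b)"
      by (rule sum.swap)
    also have "\<dots> = entry (M * (N * P)) a b"
      by (simp add: entry_times sum_distrib_left mult.assoc)
    finally show "entry (M * N * P) a b = entry (M * (N * P)) a b" .
  qed
qed (auto intro!: bmat_eqI simp: entry_times distrib_left distrib_right sum.distrib)

end

definition of_tmat :: "nat \<Rightarrow> ('n, 'a::zero) tmat \<Rightarrow> ('n, 'a) bmat" where
  "of_tmat n f = mk_bmat (\<lambda>a b. if length a = n then f a b else 0)"

lemma entry_of_tmat [simp]:
  "entry (of_tmat n f) a b = (if length a = n \<and> length b = n then f a b else 0)"
  by (auto simp: of_tmat_def)

definition unit_bmat :: "nat \<Rightarrow> ('n::finite, 'a::ring_1) bmat" where
  "unit_bmat n = of_tmat n (\<lambda>a b. if a = b then 1 else 0)"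

lemma entry_unit_bmat [simp]: "entry (unit_bmat n) a b = (if length a = n \<and> a = b then 1 else 0)"
  by (auto simp: unit_bmat_def)

text \<open>Support on a single tensor power. Constraining the row length suffices, as entries with
  unequal lengths vanish anyway.\<close>

definition homogeneous :: "nat \<Rightarrow> ('n, 'a::zero) bmat \<Rightarrow> bool" where
  "homogeneous n M \<longleftrightarrow> (\<forall>a b. length a \<noteq> n \<longrightarrow> entry M a b = 0)"

lemma entry_unit_times: "entry (unit_bmat n * M) a b = (if length a = n then entry M a b else 0)"
proof (cases "length a = n")
  case True
  then have "entry (unit_bmat n * M) a b
      = (\<Sum>c\<in>multi_indices n. if a = c then entry M c b else 0)"
    unfolding entry_times by (intro sum.cong) auto
  then show ?thesis using True by simp
qed (simp add: entry_times)

lemma entry_times_unit: "entry (M * unit_bmat n) a b = (if length a = n then entry M a b else 0)"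
proof (cases "length a = n")
  case True
  then have "entry (M * unit_bmat n) a b
      = (\<Sum>c\<in>multi_indices n. if c = b then entry M a c else 0)"
    unfolding entry_times by (intro sum.cong) auto
  then show ?thesis using True by (auto simp: entry_eq_0)
qed (auto simp: entry_times entry_eq_0 intro!: sum.neutral)

lemma homogeneous_iff_left: "homogeneous n M \<longleftrightarrow> unit_bmat n * M = M"
  by (auto simp: homogeneous_def entry_unit_times intro!: bmat_eqI) (metis entry_unit_times)

lemma homogeneous_iff_right: "homogeneous n M \<longleftrightarrow> M * unit_bmat n = M"
  by (auto simp: homogeneous_def entry_times_unit intro!: bmat_eqI) (metis entry_times_unit)

lemma homogeneous_unit_left: "homogeneous n M \<Longrightarrow> unit_bmat n * M = M"
  and homogeneous_unit_right: "homogeneous n M \<Longrightarrow> M * unit_bmat n = M"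
  by (simp_all flip: homogeneous_iff_left homogeneous_iff_right)

lemma homogeneous_of_tmat [simp]: "homogeneous n (of_tmat n f)"
  and homogeneous_unit [simp]: "homogeneous n (unit_bmat n)"
  by (auto simp: homogeneous_def)

lemma homogeneous_times [simp]: "homogeneous n M \<Longrightarrow> homogeneous n (M * N)"
  by (auto simp: homogeneous_def entry_times)

text \<open>A substitute for commutativity of the coefficient ring: it holds for matrices coming
  from the field and is what the interchange law of \<open>tens\<close> and the cyclicity of traces
  require.\<close>

definition central_entries :: "('n, 'a::ring) bmat \<Rightarrow> bool" where
  "central_entries M \<longleftrightarrow> (\<forall>a b x. entry M a b * x = x * entry M a b)"

lemma central_entriesD: "central_entries M \<Longrightarrow> entry M a b * x = x * entry M a b"
  by (simp add: central_entries_def)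

lemma central_entries_unit [simp]: "central_entries (unit_bmat n)"
  by (simp add: central_entries_def)

lemma central_entries_diff [simp]:
  "central_entries M \<Longrightarrow> central_entries N \<Longrightarrow> central_entries (M - N)"
  by (simp add: central_entries_def algebra_simps)

lemma central_entries_times [simp]:
  assumes "central_entries M" "central_entries N"
  shows "central_entries (M * N)"
proof -
  have "entry M a c * entry N c b * x = x * (entry M a c * entry N c b)" for a b c x
    using assms by (metis central_entriesD mult.assoc)
  then show ?thesis
    by (simp add: central_entries_def entry_times sum_distrib_left sum_distrib_right)
qed

text \<open>\<open>M \<otimes> N\<close> with \<open>M\<close> acting in the first \<open>p\<close> copies; entries are multiplied in this order.\<close>

definition tens :: "nat \<Rightarrow> ('n, 'a::ring) bmat \<Rightarrow> ('n, 'a) bmat \<Rightarrow> ('n, 'a) bmat" where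
  "tens p M N = mk_bmat (\<lambda>a b. if p \<le> length a
     then entry M (take p a) (take p b) * entry N (drop p a) (drop p b) else 0)"

lemma entry_tens: "entry (tens p M N) a b = (if p \<le> length a \<and> length a = length b
     then entry M (take p a) (take p b) * entry N (drop p a) (drop p b) else 0)"
  by (simp add: tens_def)

lemma entry_tens_append:
  "length c = p \<Longrightarrow> length d = p \<Longrightarrow> entry (tens p M N) (c @ a) (d @ b) = entry M c d * entry N a b"
  by (auto simp: entry_tens entry_eq_0)

lemma tens_assoc: "tens p M (tens m N P) = tens (p + m) (tens p M N) P"
  by (rule bmat_eqI) (auto simp: entry_tens mult.assoc take_drop add.commute)

lemma tens_diff_left: "tens p (M - M') N = tens p M N - tens p M' N"
  and tens_diff_right: "tens p M (N - N') = tens p M N - tens p M N'"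
  by (auto intro!: bmat_eqI simp: entry_tens algebra_simps)

lemma tens_unit:
  "tens p (unit_bmat p) (unit_bmat m) = (unit_bmat (p + m) :: ('n::finite, 'a::ring_1) bmat)"
proof (rule bmat_eqI)
  fix a b :: "'n list"
  have "take p a = take p b \<and> drop p a = drop p b \<longleftrightarrow> a = b"
    by (metis append_take_drop_id)
  then show "entry (tens p (unit_bmat p) (unit_bmat m)) a b
      = entry (unit_bmat (p + m) :: ('n, 'a) bmat) a b"
    by (auto simp: entry_tens)
qed

text \<open>In the product the entries of \<open>N\<close> stand before those of \<open>M'\<close>
  and have to be moved past them; no other pair changes its order.\<close>

lemma tens_times_tens:
  fixes M :: "('n::finite, 'a::ring) bmat"
  assumes "\<And>a b c d. entry N a b * entry M' c d = entry M' c d * entry N a b"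
  shows "tens p M N * tens p M' N' = tens p (M * M') (N * N')"
proof (rule bmat_eqI)
  fix a b :: "'n list" assume len: "length a = length b"
  show "entry (tens p M N * tens p M' N') a b = entry (tens p (M * M') (N * N')) a b"
  proof (cases "p \<le> length a")
    case True
    then obtain m where m: "length a = p + m" using le_Suc_ex by blast
    let ?a = "take p a" and ?a' = "drop p a" and ?b = "take p b" and ?b' = "drop p b"
    have *: "entry M ?a c * entry N ?a' d * (entry M' c ?b * entry N' d ?b')
        = entry M ?a c * entry M' c ?b * (entry N ?a' d * entry N' d ?b')" for c d
      using assms by (metis mult.assoc)
    have "entry (tens p M N * tens p M' N') a b = (\<Sum>c\<in>multi_indices p. \<Sum>d\<in>multi_indices m.
        entry M ?a c * entry N ?a' d * (entry M' c ?b * entry N' d ?b'))"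
      unfolding entry_times m sum_multi_indices_add
      using len m by (intro sum.cong) (simp_all add: entry_tens)
    also have "\<dots> = entry (tens p (M * M') (N * N')) a b"
      using m len by (simp add: * entry_tens entry_times sum_product)
    finally show ?thesis .
  qed (simp add: entry_times entry_tens)
qed

lemma tens_times_tens_central_left:
  "central_entries N \<Longrightarrow> tens p M N * tens p M' N' = tens p (M * M') (N * N')"
  and tens_times_tens_central_right:
  "central_entries M' \<Longrightarrow> tens p M N * tens p M' N' = tens p (M * M') (N * N')"
  by (rule tens_times_tens; metis central_entriesD)+

lemma homogeneous_tens:
  assumes "homogeneous p M" "homogeneous m N"
  shows "homogeneous (p + m) (tens p M N)"
  unfolding homogeneous_def
proof (intro allI impI)
  fix a b :: "'a list" assume "length a \<noteq> p + m"
  then have "length (take p a) \<noteq> p \<or> length (drop p a) \<noteq> m" by auto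
  then show "entry (tens p M N) a b = 0"
    using assms by (auto simp: entry_tens homogeneous_def)
qed

lemma central_entries_tens [simp]:
  assumes "central_entries M" "central_entries N"
  shows "central_entries (tens p M N)"
proof -
  have "entry M a b * entry N c d * x = x * (entry M a b * entry N c d)" for a b c d x
    by (metis central_entriesD[OF assms(1)] central_entriesD[OF assms(2)] mult.assoc)
  then show ?thesis by (auto simp: central_entries_def entry_tens)
qed

lemma
  fixes M :: "('n::finite, 'a::ring_1) bmat"
  assumes "homogeneous m M"
  shows tens_unit_0_left: "tens 0 (unit_bmat 0) M = M"
    and tens_unit_0_right: "tens m M (unit_bmat 0) = M"
  using assms
  by (auto intro!: bmat_eqI simp: entry_tens homogeneous_def)

text \<open>The entries of \<open>T_1 \<cdots> T_n\<close>, for \<open>t\<close> the entries of \<open>T\<close>.\<close>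

definition word_prod :: "('n \<Rightarrow> 'n \<Rightarrow> 'a::ring_1) \<Rightarrow> nat \<Rightarrow> ('n, 'a) bmat" where
  "word_prod t n = of_tmat n (\<lambda>a b. prod_list (map2 t a b))"

lemma homogeneous_word_prod [simp]: "homogeneous n (word_prod t n)"
  by (simp add: word_prod_def)

lemma tens_word_prod: "tens p (word_prod t p) (word_prod t m) = word_prod t (p + m)"
proof (rule bmat_eqI)
  fix a b :: "'a list" assume len: "length a = length b"
  show "entry (tens p (word_prod t p) (word_prod t m)) a b = entry (word_prod t (p + m)) a b"
  proof (cases "length a = p + m")
    case True
    have "map2 t a b = map2 t (take p a @ drop p a) (take p b @ drop p b)" by simp
    also have "\<dots> = map2 t (take p a) (take p b) @ map2 t (drop p a) (drop p b)"
      using len by (subst zip_append) auto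
    finally show ?thesis using True len by (simp add: word_prod_def entry_tens)
  qed (use len in \<open>auto simp: word_prod_def entry_tens\<close>)
qed

section \<open>Total and partial traces\<close>

definition full_tr :: "nat \<Rightarrow> ('n::finite, 'a::ring) bmat \<Rightarrow> 'a" where
  "full_tr n M = (\<Sum>c\<in>multi_indices n. entry M c c)"

definition lower_tr :: "nat \<Rightarrow> ('n::finite, 'a::ring) bmat \<Rightarrow> 'n \<Rightarrow> 'n \<Rightarrow> 'a" where
  "lower_tr n M i j = (\<Sum>c\<in>multi_indices (n - 1). entry M (c @ [i]) (c @ [j]))"

definition upper_tr :: "nat \<Rightarrow> ('n::finite, 'a::ring) bmat \<Rightarrow> 'n \<Rightarrow> 'n \<Rightarrow> 'a" where
  "upper_tr n M i j = (\<Sum>c\<in>multi_indices (n - 1). entry M (i # c) (j # c))"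

lemma lower_tr_diff: "lower_tr n (M - N) i j = lower_tr n M i j - lower_tr n N i j"
  and upper_tr_diff: "upper_tr n (M - N) i j = upper_tr n M i j - upper_tr n N i j"
  by (simp_all add: lower_tr_def upper_tr_def sum_subtractf)

text \<open>The untraced copy is the last one. With \<open>0 < m\<close> it lies in the second
  factor, so the first is traced completely; this is where the factors sigma come from.\<close>

lemma lower_tr_tens:
  assumes "0 < m"
  shows "lower_tr (p + m) (tens p M N) i j = full_tr p M * lower_tr m N i j"
proof -
  have "p + m - 1 = p + (m - 1)" using assms by simp
  then show ?thesis
    by (simp add: lower_tr_def full_tr_def sum_product sum_multi_indices_add entry_tens_append)
qed

lemma upper_tr_tens:
  assumes "0 < p"
  shows "upper_tr (p + m) (tens p M N) i j = upper_tr p M i j * full_tr m N"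
proof -
  have "p + m - 1 = (p - 1) + m" using assms by simp
  then have "upper_tr (p + m) (tens p M N) i j = (\<Sum>c\<in>multi_indices (p - 1).
      \<Sum>d\<in>multi_indices m. entry (tens p M N) ((i # c) @ d) ((j # c) @ d))"
    by (simp add: upper_tr_def sum_multi_indices_add)
  also have "\<dots> = (\<Sum>c\<in>multi_indices (p - 1). \<Sum>d\<in>multi_indices m.
      entry M (i # c) (j # c) * entry N d d)"
    using assms by (intro sum.cong refl entry_tens_append) auto
  finally show ?thesis by (simp add: upper_tr_def full_tr_def sum_product)
qed

text \<open>The identity in the last copy keeps \<open>i\<close> and \<open>j\<close> in place, and
  the central entries of \<open>M\<close> may be moved across those of the arbitrary matrix
  \<open>Y\<close>.\<close>

lemma lower_tr_cyclic:
  fixes Y :: "('n::finite, 'a::ring_1) bmat"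
  assumes "0 < n" "central_entries M"
  shows "lower_tr n (Y * tens (n - 1) M (unit_bmat 1)) i j
    = lower_tr n (tens (n - 1) M (unit_bmat 1) * Y) i j"
proof -
  have n: "Suc (n - 1) = (n - 1) + Suc 0" using assms by simp
  let ?M = "tens (n - 1) M (unit_bmat 1)"
  have ite: "x * (if P then y else 0) = (if P then x * y else 0)"
      "(if P then y else 0) * x = (if P then y * x else 0)" for x y :: 'a and P
    by auto
  have "lower_tr n (Y * ?M) i j = (\<Sum>c\<in>multi_indices (n - 1). \<Sum>d\<in>multi_indices (n - 1).
      entry Y (c @ [i]) (d @ [j]) * entry M d c)"
    unfolding lower_tr_def
    by (rule sum.cong) (auto simp: entry_times n sum_multi_indices_add
      sum_multi_indices_1 entry_tens_append ite simp del: add_Suc_right)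
  also have "\<dots> = (\<Sum>d\<in>multi_indices (n - 1). \<Sum>c\<in>multi_indices (n - 1).
      entry M d c * entry Y (c @ [i]) (d @ [j]))"
    by (subst sum.swap) (simp add: central_entriesD[OF assms(2)])
  also have "\<dots> = lower_tr n (?M * Y) i j"
    unfolding lower_tr_def
    by (rule sum.cong) (auto simp: entry_times n sum_multi_indices_add
      sum_multi_indices_1 entry_tens_append ite simp del: add_Suc_right)
  finally show ?thesis .
qed

lemma upper_tr_cyclic:
  fixes Y :: "('n::finite, 'a::ring_1) bmat"
  assumes "0 < n" "central_entries M"
  shows "upper_tr n (Y * tens 1 (unit_bmat 1) M) i j = upper_tr n (tens 1 (unit_bmat 1) M * Y) i j"
proof -
  let ?M = "tens 1 (unit_bmat 1) M"
  have ite: "x * (if P then y else 0) = (if P then x * y else 0)"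
      "(if P then y else 0) * x = (if P then y * x else 0)" for x y :: 'a and P
    by auto
  have *: "entry ?M (a # c) (b # d) = (if a = b then entry M c d else 0)" for a b c d
    using entry_tens_append[of "[a]" 1 "[b]" "unit_bmat 1" M c d] by simp
  have "upper_tr n (Y * ?M) i j = (\<Sum>c\<in>multi_indices (n - 1). \<Sum>d\<in>multi_indices (n - 1).
      entry Y (i # c) (j # d) * entry M d c)"
    unfolding upper_tr_def
    by (rule sum.cong) (auto simp: entry_times sum_multi_indices_Suc *[simplified] ite sum.swap[of _ _ UNIV])
  also have "\<dots> = (\<Sum>d\<in>multi_indices (n - 1). \<Sum>c\<in>multi_indices (n - 1).
      entry M d c * entry Y (i # c) (j # d))"
    by (subst sum.swap) (simp add: central_entriesD[OF assms(2)])
  also have "\<dots> = upper_tr n (?M * Y) i j"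
    unfolding upper_tr_def
    by (rule sum.cong) (auto simp: entry_times sum_multi_indices_Suc *[simplified] ite sum.swap[of _ _ UNIV])
  finally show ?thesis .
qed


section \<open>Hecke matrices\<close>

text \<open>Central images of the scalars let field matrices and the matrix \<open>T\<close> be
  multiplied over one coefficient ring.\<close>

locale scalar_hom =
  fixes \<phi> :: "'k::field \<Rightarrow> 'a::ring_1"
  assumes hom_add: "\<phi> (c + d) = \<phi> c + \<phi> d"
    and hom_mult: "\<phi> (c * d) = \<phi> c * \<phi> d"
    and hom_one [simp]: "\<phi> 1 = 1"
    and hom_central: "\<phi> c * x = x * \<phi> c"
begin

lemma hom_zero [simp]: "\<phi> 0 = 0"
  using hom_add[of 0 0] by simp

lemma hom_minus: "\<phi> (- c) = - \<phi> c"
  by (rule minus_unique[symmetric]) (simp flip: hom_add)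

lemma hom_diff: "\<phi> (c - d) = \<phi> c - \<phi> d"
  using hom_add[of c "- d"] by (simp add: hom_minus)

lemma hom_sum: "\<phi> (sum f A) = (\<Sum>x\<in>A. \<phi> (f x))"
  by (induction A rule: infinite_finite_induct) (auto simp: hom_add)

definition scl :: "'k \<Rightarrow> ('n, 'a) bmat \<Rightarrow> ('n, 'a) bmat" where
  "scl c M = mk_bmat (\<lambda>a b. \<phi> c * entry M a b)"

lemma entry_scl [simp]: "entry (scl c M) a b = \<phi> c * entry M a b"
  by (simp add: scl_def entry_eq_0)

sublocale scaled_ring "scl :: 'k \<Rightarrow> ('n::finite, 'a) bmat \<Rightarrow> ('n, 'a) bmat"
proof
  fix c :: 'k and M N :: "('n, 'a) bmat"
  have "entry M a d * (\<phi> c * entry N d b) = \<phi> c * (entry M a d * entry N d b)" for a b d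
    by (metis hom_central mult.assoc)
  then show "M * scl c N = scl c (M * N)"
    by (intro bmat_eqI) (simp add: entry_times sum_distrib_left)
qed (auto intro!: bmat_eqI simp: distrib_left distrib_right hom_add hom_mult mult.assoc
    entry_times sum_distrib_left)

lemma central_entries_scl [simp]: "central_entries M \<Longrightarrow> central_entries (scl c M)"
  unfolding central_entries_def entry_scl by (metis hom_central mult.assoc)

lemma tens_scl_left: "tens p (scl c M) N = scl c (tens p M N)"
  by (rule bmat_eqI) (auto simp: entry_tens mult.assoc)

lemma tens_scl_right: "tens p M (scl c N) = scl c (tens p M N)"
proof (rule bmat_eqI)
  fix a b :: "'b list"
  have "x * (\<phi> c * y) = \<phi> c * (x * y)" for x y by (metis hom_central mult.assoc)
  then show "entry (tens p M (scl c N)) a b = entry (scl c (tens p M N)) a b"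
    by (simp add: entry_tens)
qed

lemma lower_tr_scl: "lower_tr n (scl c M) i j = \<phi> c * lower_tr n M i j"
  and upper_tr_scl: "upper_tr n (scl c M) i j = \<phi> c * upper_tr n M i j"
  by (simp_all add: lower_tr_def upper_tr_def sum_distrib_left)

end

locale hecke_matrix = scalar_hom \<phi> + q_generic q
  for \<phi> :: "'k::field \<Rightarrow> 'a::ring_1" and q :: 'k +
  fixes Rm :: "('n::finite, 'a) bmat"
  assumes homogeneous_R: "homogeneous 2 Rm"
    and central_R: "central_entries Rm"
    and R_quadratic: "(Rm - scl q (unit_bmat 2)) * (Rm + scl (inverse q) (unit_bmat 2)) = 0"
    and R_braid: "tens 2 Rm (unit_bmat 1) * tens 1 (unit_bmat 1) Rm * tens 2 Rm (unit_bmat 1)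
      = tens 1 (unit_bmat 1) Rm * tens 2 Rm (unit_bmat 1) * tens 1 (unit_bmat 1) Rm"
begin

text \<open>\<open>gen n i\<close> is \<open>R_i\<close> on \<open>V^{\<otimes>n}\<close> and \<open>chain n i j\<close> is \<open>R_i \<cdots> R_{j-1}\<close>. On \<open>V^{\<otimes>n}\<close>, \<open>anti n m\<close> is
  the antisymmetrizer in the first \<open>m\<close> copies, \<open>rev_anti n m\<close> the one in the last \<open>m\<close> copies, built
  by the mirrored recursion.\<close>

definition gen :: "nat \<Rightarrow> nat \<Rightarrow> ('n, 'a) bmat" where
  "gen n i = tens (i - 1) (unit_bmat (i - 1)) (tens 2 Rm (unit_bmat (n - i - 1)))"

lemma homogeneous_gen:
  assumes "1 \<le> i" "i < n"
  shows "homogeneous n (gen n i)"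
proof -
  have "homogeneous ((i - 1) + (2 + (n - i - 1))) (gen n i)"
    unfolding gen_def by (intro homogeneous_tens homogeneous_R homogeneous_unit)
  moreover have "(i - 1) + (2 + (n - i - 1)) = n" using assms by linarith
  ultimately show ?thesis by (simp only:)
qed

lemma central_gen [simp]: "central_entries (gen n i)"
  by (simp add: gen_def central_R)

text \<open>Only copies i and i+1 are affected, so the identity on the copies before them may be
  regrouped at any position \<open>p < i\<close>.\<close>

lemma gen_shift:
  assumes "p < i" "i < n"
  shows "gen n i = tens p (unit_bmat p) (gen (n - p) (i - p))"
proof -
  have "i - 1 = p + (i - p - 1)" using assms by simp
  then have "gen n i = tens (p + (i - p - 1)) (tens p (unit_bmat p) (unit_bmat (i - p - 1)))
      (tens 2 Rm (unit_bmat (n - i - 1)))"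
    unfolding gen_def tens_unit by metis
  moreover have "i - p - 1 = (i - p) - 1" "n - i - 1 = n - p - (i - p) - 1"
    using assms by auto
  ultimately show ?thesis by (simp only: gen_def tens_assoc add.assoc)
qed

lemma gen_extend:
  assumes "1 \<le> i" "i < m" "m \<le> n"
  shows "gen n i = tens m (gen m i) (unit_bmat (n - m))"
proof -
  have m: "m = (i - 1) + (2 + (m - i - 1))" using assms by simp
  have "n - i - 1 = (m - i - 1) + (n - m)" using assms by simp
  then have "gen n i = tens (i - 1) (unit_bmat (i - 1))
      (tens 2 Rm (tens (m - i - 1) (unit_bmat (m - i - 1)) (unit_bmat (n - m))))"
    unfolding gen_def tens_unit by metis
  also have "\<dots> = tens m (gen m i) (unit_bmat (n - m))"
    unfolding gen_def tens_assoc using m by (metis add.assoc)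
  finally show ?thesis .
qed

lemma hecke_gen: "hecke scl q (unit_bmat n) (gen n) n"
proof unfold_locales
  show "unit_bmat n * unit_bmat n = (unit_bmat n :: ('n, 'a) bmat)"
    by (simp add: homogeneous_unit_left)
next
  fix i assume i: "1 \<le> i" "i < n"
  show "unit_bmat n * gen n i = gen n i" "gen n i * unit_bmat n = gen n i"
    using homogeneous_gen[OF i] by (simp_all add: homogeneous_unit_left homogeneous_unit_right)
  \<comment> \<open>\<open>f\<close> embeds operators on two copies as operators on copies i, i+1.
    Being additive and multiplicative, it transports the quadratic relation.\<close>
  define f where "f M = tens (i - 1) (unit_bmat (i - 1)) (tens 2 M (unit_bmat (n - i - 1)))"
    for M :: "('n, 'a) bmat"
  have f_mult: "f (M * N) = f M * f N" for M N
    by (simp add: f_def tens_times_tens_central_left tens_times_tens_central_right homogeneous_unit_left)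
  have f_scl: "f (scl c M) = scl c (f M)" for c M
    by (simp add: f_def tens_scl_left tens_scl_right)
  have f_diff: "f (M - N) = f M - f N" for M N
    by (simp add: f_def tens_diff_left tens_diff_right)
  have f_zero: "f 0 = 0" using f_diff[of 0 0] by simp
  have f_add: "f (M + N) = f M + f N" for M N
    using f_diff[of M "- N"] f_diff[of 0 N] f_zero by simp
  have f_unit: "f (unit_bmat 2) = unit_bmat n"
  proof -
    have "(i - 1) + (2 + (n - i - 1)) = n" using i by linarith
    then show ?thesis by (simp only: f_def tens_unit)
  qed
  have "gen n i = f Rm" by (simp add: gen_def f_def)
  then have "(gen n i - scl q (unit_bmat n)) * (gen n i + scl (inverse q) (unit_bmat n))
      = f ((Rm - scl q (unit_bmat 2)) * (Rm + scl (inverse q) (unit_bmat 2)))"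
    by (simp only: f_mult f_diff f_add f_scl f_unit)
  then show "(gen n i - scl q (unit_bmat n)) * (gen n i + scl (inverse q) (unit_bmat n)) = 0"
    by (simp add: R_quadratic f_zero)
next
  fix i assume i: "1 \<le> i" "i + 1 < n"
  \<comment> \<open>The same embedding for copies i, i+1, i+2; it carries the braid relation from
    the third tensor power.\<close>
  define f where "f M = tens (i - 1) (unit_bmat (i - 1)) (tens 3 M (unit_bmat (n - i - 2)))"
    for M :: "('n, 'a) bmat"
  have f_mult: "f (M * N) = f M * f N" for M N
    by (simp add: f_def tens_times_tens_central_left tens_times_tens_central_right homogeneous_unit_left)
  have gen_3: "gen 3 1 = tens 2 Rm (unit_bmat 1)" "gen 3 2 = tens 1 (unit_bmat 1) Rm"
    using tens_unit_0_left[OF homogeneous_tens[OF homogeneous_R homogeneous_unit, of 1]]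
      tens_unit_0_right[OF homogeneous_R] by (simp_all add: gen_def)
  have arith: "i - (i - 1) = 1" "i + 1 - (i - 1) = 2" "n - (i - 1) - 3 = n - i - 2"
    using i by auto
  have "gen (n - (i - 1)) 1 = tens 3 (gen 3 1) (unit_bmat (n - i - 2))"
    "gen (n - (i - 1)) 2 = tens 3 (gen 3 2) (unit_bmat (n - i - 2))"
    using gen_extend[of 1 3 "n - (i - 1)"] gen_extend[of 2 3 "n - (i - 1)"] i
    unfolding arith by auto
  then have "gen n i = f (gen 3 1)" "gen n (i + 1) = f (gen 3 2)"
    using gen_shift[of "i - 1" i n] gen_shift[of "i - 1" "i + 1" n] i
    unfolding arith f_def by auto
  then show "gen n i * gen n (i + 1) * gen n i = gen n (i + 1) * gen n i * gen n (i + 1)"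
    by (simp only: f_mult[symmetric] gen_3 R_braid)
next
  fix i j assume "1 \<le> i" "i + 2 \<le> j" "j < n"
  \<comment> \<open>Cutting behind copy i+1 puts the two generators into different tensor
    factors.\<close>
  then have "gen n i = tens (i + 1) (gen (i + 1) i) (unit_bmat (n - (i + 1)))"
    "gen n j = tens (i + 1) (unit_bmat (i + 1)) (gen (n - (i + 1)) (j - (i + 1)))"
    "homogeneous (i + 1) (gen (i + 1) i)" "homogeneous (n - (i + 1)) (gen (n - (i + 1)) (j - (i + 1)))"
    by (auto intro!: gen_extend gen_shift homogeneous_gen)
  then show "gen n i * gen n j = gen n j * gen n i"
    by (simp add: tens_times_tens_central_left homogeneous_unit_left homogeneous_unit_right)
qed

sublocale H: hecke scl q "unit_bmat n" "gen n" n for n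
  by (rule hecke_gen)

definition anti :: "nat \<Rightarrow> nat \<Rightarrow> ('n, 'a) bmat" where
  "anti n = asym q (unit_bmat n) (gen n)"

definition rev_anti :: "nat \<Rightarrow> nat \<Rightarrow> ('n, 'a) bmat" where
  "rev_anti n = asym q (unit_bmat n) (\<lambda>i. gen n (n - i))"

definition chain :: "nat \<Rightarrow> nat \<Rightarrow> nat \<Rightarrow> ('n, 'a) bmat" where
  "chain n i j = foldr (\<lambda>l M. gen n l * M) [i..<j] (unit_bmat n)"

lemma central_anti [simp]: "central_entries (anti n m)"
  unfolding anti_def by (rule asym_induct) auto

lemma central_chain [simp]: "central_entries (chain n i j)"
proof -
  have "central_entries (foldr (\<lambda>l M. gen n l * M) ls (unit_bmat n))" for ls
    by (induction ls) auto
  then show ?thesis by (simp add: chain_def)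
qed

text \<open>Used with \<open>m = m'\<close> to factorize a trace, and with \<open>m = n - 1\<close>
  to show that the last copy is untouched, as cyclicity requires.\<close>

lemma anti_extend:
  assumes "m' \<le> m" "m \<le> n"
  shows "anti n m' = tens m (anti m m') (unit_bmat (n - m))"
  unfolding anti_def
  by (rule asym_hom[symmetric, where f = "\<lambda>M. tens m M (unit_bmat (n - m))"])
    (use assms in \<open>auto simp: tens_unit gen_extend[of _ m n, symmetric] tens_diff_left tens_scl_left
      tens_times_tens_central_left homogeneous_unit_left\<close>)

lemma rev_anti_full: "rev_anti n n = anti n n"
  unfolding anti_def rev_anti_def by (rule H.asym_reverse)

text \<open>The mirrored recursion in the last \<open>m\<close> copies is the shifted mirrored
  recursion on the m-th tensor power. By \<open>rev_anti_full\<close> its result there is the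
  ordinary antisymmetrizer, so its full trace again produces sigma_m.\<close>

lemma rev_anti_shift:
  assumes "m \<le> n"
  shows "rev_anti n m = tens (n - m) (unit_bmat (n - m)) (anti m m)"
  unfolding rev_anti_full[symmetric]
  unfolding rev_anti_def
proof (rule asym_hom[symmetric])
  fix i assume "1 \<le> i" "i < m"
  then show "tens (n - m) (unit_bmat (n - m)) (gen m (m - i)) = gen n (n - i)"
    using gen_shift[of "n - m" "n - i" n] assms by simp
qed (use assms in \<open>auto simp: tens_unit tens_diff_right tens_scl_right
      tens_times_tens_central_left tens_times_tens_central_right homogeneous_unit_left\<close>)

section \<open>Products of consecutive generators\<close>

lemma foldr_mult_right:
  fixes g :: "'b \<Rightarrow> 'c::semigroup_mult"
  shows "foldr (\<lambda>l M. g l * M) ls (u * z) = foldr (\<lambda>l M. g l * M) ls u * z"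
  by (induction ls) (auto simp: mult.assoc)

lemma foldr_mult_hom:
  fixes g :: "'b \<Rightarrow> 'c::semigroup_mult" and g' :: "'b \<Rightarrow> 'd::semigroup_mult"
  assumes "\<And>x y. f (x * y) = f x * f y" and "\<And>l. l \<in> set ls \<Longrightarrow> f (g l) = g' l" and "f u = u'"
  shows "f (foldr (\<lambda>l M. g l * M) ls u) = foldr (\<lambda>l M. g' l * M) ls u'"
  using assms(2) by (induction ls) (auto simp: assms)

lemma chain_empty [simp]: "j \<le> i \<Longrightarrow> chain n i j = unit_bmat n"
  by (simp add: chain_def)

lemma chain_rec: "i < j \<Longrightarrow> chain n i j = gen n i * chain n (Suc i) j"
  by (simp add: chain_def upt_conv_Cons)

lemma chain_Suc:
  assumes "1 \<le> i" "i \<le> j" "j < n"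
  shows "chain n i (Suc j) = chain n i j * gen n j"
proof -
  have "gen n j * unit_bmat n = unit_bmat n * gen n j"
    using assms homogeneous_gen[of j n] by (simp add: homogeneous_unit_left homogeneous_unit_right)
  then show ?thesis
    using assms by (simp add: chain_def foldr_mult_right)
qed

lemma homogeneous_chain: "1 \<le> i \<Longrightarrow> j \<le> n \<Longrightarrow> homogeneous n (chain n i j)"
  by (cases "i < j") (auto simp: chain_rec homogeneous_gen)

lemma chain_shift:
  assumes "p < n"
  shows "chain n (Suc p) n = tens p (unit_bmat p) (chain (n - p) 1 (n - p))"
proof -
  have "[Suc p..<n] = map (\<lambda>l. l + p) [1..<n - p]"
    by (rule nth_equalityI) auto
  moreover have "tens p (unit_bmat p) (chain (n - p) 1 (n - p))
      = foldr (\<lambda>l M. gen n (l + p) * M) [1..<n - p] (unit_bmat n)"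
    unfolding chain_def
  proof (rule foldr_mult_hom)
    fix l assume "l \<in> set [1..<n - p]"
    then show "tens p (unit_bmat p) (gen (n - p) l) = gen n (l + p)"
      using gen_shift[of p "l + p" n] by (simp add: less_diff_conv)
  qed (use assms in \<open>auto simp: tens_times_tens_central_right tens_unit homogeneous_unit_left\<close>)
  ultimately show ?thesis by (simp add: chain_def foldr_map comp_def)
qed

lemma chain_extend:
  assumes "p \<le> n"
  shows "chain n 1 p = tens p (chain p 1 p) (unit_bmat (n - p))"
  unfolding chain_def
  by (rule foldr_mult_hom[symmetric]) (use assms in \<open>auto simp: tens_times_tens_central_left tens_unit
        homogeneous_unit_left gen_extend[of _ p n, symmetric]\<close>)

text \<open>The antisymmetrizer involves R_1,...,R_{m-1} and the chain starts at R_{m+1}; the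
  linking generator R_m is left out.\<close>

lemma anti_chain:
  assumes "m < n"
  shows "anti n m * chain n (Suc m) n = chain n (Suc m) n * anti n m"
proof -
  have "anti n m * foldr (\<lambda>l M. gen n l * M) ls (unit_bmat n)
      = foldr (\<lambda>l M. gen n l * M) ls (unit_bmat n) * anti n m"
    if "set ls \<subseteq> {Suc m..<n}" for ls
    using that
  proof (induction ls)
    case Nil
    then show ?case using assms by (simp add: anti_def)
  next
    case (Cons l ls)
    let ?F = "foldr (\<lambda>l M. gen n l * M) ls (unit_bmat n)"
    from Cons have comm: "anti n m * gen n l = gen n l * anti n m"
      unfolding anti_def by (intro H.asym_far) auto
    have "anti n m * (gen n l * ?F) = gen n l * (anti n m * ?F)"
      by (simp only: comm flip: mult.assoc)
    also have "\<dots> = gen n l * ?F * anti n m"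
      using Cons by (simp add: mult.assoc)
    finally show ?case by simp
  qed
  then show ?thesis unfolding chain_def by (metis atLeastLessThan_upt subset_refl)
qed

text \<open>Here the chain ends at R_{n-m-1} and the projector involves R_{n-m+1},...,R_{n-1}; the
  missing link is R_{n-m}.\<close>

lemma rev_anti_chain:
  assumes "m < n"
  shows "rev_anti n m * chain n 1 (n - m) = chain n 1 (n - m) * rev_anti n m"
proof -
  interpret rev: hecke scl q "unit_bmat n" "\<lambda>i. gen n (n - i)" n by (rule H.hecke_reverse)
  have "rev_anti n m * foldr (\<lambda>l M. gen n l * M) ls (unit_bmat n)
      = foldr (\<lambda>l M. gen n l * M) ls (unit_bmat n) * rev_anti n m"
    if "set ls \<subseteq> {1..<n - m}" for ls
    using that
  proof (induction ls)
    case Nil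
    then show ?case using assms by (simp add: rev_anti_def)
  next
    case (Cons l ls)
    let ?F = "foldr (\<lambda>l M. gen n l * M) ls (unit_bmat n)"
    from Cons have comm: "rev_anti n m * gen n l = gen n l * rev_anti n m"
      using rev.asym_far[of m "n - l"] by (auto simp: rev_anti_def)
    have "rev_anti n m * (gen n l * ?F) = gen n l * (rev_anti n m * ?F)"
      by (simp only: comm flip: mult.assoc)
    also have "\<dots> = gen n l * ?F * rev_anti n m"
      using Cons by (simp add: mult.assoc)
    finally show ?case by simp
  qed
  then show ?thesis unfolding chain_def by (metis atLeastLessThan_upt subset_refl)
qed

end


section \<open>The identities modulo the RTT relations\<close>

text \<open>A congruence modulo \<open>I\<close> in place of a quotient keeps all entries in a
  type-class ring, so the matrix calculus above applies unchanged.\<close>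

locale rtt_matrix = hecke_matrix \<phi> q Rm
  for \<phi> :: "'k::field \<Rightarrow> 'a::ring_1" and q :: 'k and Rm :: "('n::finite, 'a) bmat" +
  fixes t :: "'n \<Rightarrow> 'n \<Rightarrow> 'a" and I :: "'a set"
  assumes ideal_zero [simp]: "0 \<in> I"
    and ideal_add: "x \<in> I \<Longrightarrow> y \<in> I \<Longrightarrow> x + y \<in> I"
    and ideal_mult_left: "x \<in> I \<Longrightarrow> z * x \<in> I"
    and ideal_mult_right: "x \<in> I \<Longrightarrow> x * z \<in> I"
    and rtt: "entry (Rm * word_prod t 2 - word_prod t 2 * Rm) a b \<in> I"
begin

lemma ideal_minus: "x \<in> I \<Longrightarrow> - x \<in> I"
  using ideal_mult_left[of x "- 1"] by simp

lemma ideal_sum: "(\<And>x. x \<in> A \<Longrightarrow> f x \<in> I) \<Longrightarrow> sum f A \<in> I"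
  by (induction A rule: infinite_finite_induct) (auto intro: ideal_add)

definition eqv :: "'a \<Rightarrow> 'a \<Rightarrow> bool" (infix "\<approx>\<^sub>I" 50) where
  "x \<approx>\<^sub>I y \<longleftrightarrow> x - y \<in> I"

lemma eqv_refl [simp]: "x \<approx>\<^sub>I x"
  by (simp add: eqv_def)

lemma eqv_sym: "x \<approx>\<^sub>I y \<Longrightarrow> y \<approx>\<^sub>I x"
  using ideal_minus[of "x - y"] by (simp add: eqv_def)

lemma eqv_trans [trans]: "x \<approx>\<^sub>I y \<Longrightarrow> y \<approx>\<^sub>I z \<Longrightarrow> x \<approx>\<^sub>I z"
  using ideal_add[of "x - y" "y - z"] by (simp add: eqv_def)

lemma eqv_diff: "x \<approx>\<^sub>I x' \<Longrightarrow> y \<approx>\<^sub>I y' \<Longrightarrow> x - y \<approx>\<^sub>I x' - y'"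
  using ideal_add[of "x - x'" "- (y - y')"] ideal_minus[of "y - y'"]
  by (simp add: eqv_def algebra_simps)

lemma eqv_mult_left: "x \<approx>\<^sub>I y \<Longrightarrow> z * x \<approx>\<^sub>I z * y"
  using ideal_mult_left[of "x - y" z] by (simp add: eqv_def right_diff_distrib)

definition null_bmat :: "('n, 'a) bmat \<Rightarrow> bool" where
  "null_bmat M \<longleftrightarrow> (\<forall>a b. entry M a b \<in> I)"

lemma null_bmat_zero [simp]: "null_bmat 0"
  by (simp add: null_bmat_def)

lemma null_bmat_add: "null_bmat M \<Longrightarrow> null_bmat N \<Longrightarrow> null_bmat (M + N)"
  by (simp add: null_bmat_def ideal_add)

lemma null_bmat_diff: "null_bmat M \<Longrightarrow> null_bmat N \<Longrightarrow> null_bmat (M - N)"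
  using ideal_add ideal_minus by (metis null_bmat_def entry_minus diff_conv_add_uminus)

lemma null_bmat_scl: "null_bmat M \<Longrightarrow> null_bmat (scl c M)"
  by (simp add: null_bmat_def ideal_mult_left)

lemma null_bmat_times_left: "null_bmat M \<Longrightarrow> null_bmat (N * M)"
  and null_bmat_times_right: "null_bmat M \<Longrightarrow> null_bmat (M * N)"
  by (auto simp: null_bmat_def entry_times intro: ideal_sum ideal_mult_left ideal_mult_right)

lemma null_bmat_tens: "null_bmat M \<or> null_bmat N \<Longrightarrow> null_bmat (tens p M N)"
  by (auto simp: null_bmat_def entry_tens intro: ideal_mult_left ideal_mult_right)

lemma lower_tr_eqv: "null_bmat (M - N) \<Longrightarrow> lower_tr n M i j \<approx>\<^sub>I lower_tr n N i j"
  unfolding eqv_def lower_tr_diff[symmetric]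
  by (auto simp: null_bmat_def lower_tr_def intro!: ideal_sum simp del: entry_minus)

lemma upper_tr_eqv: "null_bmat (M - N) \<Longrightarrow> upper_tr n M i j \<approx>\<^sub>I upper_tr n N i j"
  unfolding eqv_def upper_tr_diff[symmetric]
  by (auto simp: null_bmat_def upper_tr_def intro!: ideal_sum simp del: entry_minus)

text \<open>T_1 ... T_n splits as a tensor product around copies i, i+1. The outer factors meet only
  identities, so the difference is the RTT relation placed in the middle.\<close>

lemma gen_word_prod:
  assumes "1 \<le> i" "i < n"
  shows "null_bmat (gen n i * word_prod t n - word_prod t n * gen n i)"
proof -
  let ?p = "i - 1" and ?m = "n - i - 1"
  have n: "?p + (2 + ?m) = n" using assms by linarith
  have wp: "word_prod t n = tens ?p (word_prod t ?p) (tens 2 (word_prod t 2) (word_prod t ?m))"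
    by (simp only: n tens_word_prod)
  have "gen n i * word_prod t n = tens ?p (word_prod t ?p) (tens 2 (Rm * word_prod t 2) (word_prod t ?m))"
    unfolding wp gen_def
    by (simp add: tens_times_tens_central_left central_R homogeneous_unit_left)
  moreover have "word_prod t n * gen n i
      = tens ?p (word_prod t ?p) (tens 2 (word_prod t 2 * Rm) (word_prod t ?m))"
    unfolding wp gen_def
    by (simp add: tens_times_tens_central_right central_R homogeneous_unit_right)
  moreover have "null_bmat (Rm * word_prod t 2 - word_prod t 2 * Rm)"
    using rtt by (simp add: null_bmat_def)
  ultimately show ?thesis
    by (simp add: null_bmat_tens flip: tens_diff_right tens_diff_left)
qed

lemma asym_word_prod:
  assumes "m \<le> n" and "\<And>i. 1 \<le> i \<Longrightarrow> i < m \<Longrightarrow> \<exists>l. 1 \<le> l \<and> l < n \<and> S i = gen n l"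
  shows "null_bmat (asym q (unit_bmat n) S m * word_prod t n
    - word_prod t n * asym q (unit_bmat n) S m)"
proof (rule asym_induct[where P = "\<lambda>M. null_bmat (M * word_prod t n - word_prod t n * M)"])
  let ?w = "word_prod t n"
  show "null_bmat (unit_bmat n * ?w - ?w * unit_bmat n)"
    by (simp add: homogeneous_unit_left homogeneous_unit_right)
  show "null_bmat (S i * ?w - ?w * S i)" if "1 \<le> i" "i < m" for i
    using assms(2)[OF that] gen_word_prod by auto
  fix M N assume M: "null_bmat (M * ?w - ?w * M)" and N: "null_bmat (N * ?w - ?w * N)"
  have "(M - N) * ?w - ?w * (M - N) = (M * ?w - ?w * M) - (N * ?w - ?w * N)"
    by (simp add: algebra_simps)
  then show "null_bmat ((M - N) * ?w - ?w * (M - N))"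
    using null_bmat_diff[OF M N] by simp
  \<comment> \<open>The Leibniz rule for commutators with \<open>?w\<close>.\<close>
  have "(M * N) * ?w - ?w * (M * N) = M * (N * ?w - ?w * N) + (M * ?w - ?w * M) * N"
    by (simp add: algebra_simps)
  then show "null_bmat ((M * N) * ?w - ?w * (M * N))"
    using null_bmat_add[OF null_bmat_times_left[OF N] null_bmat_times_right[OF M]] by simp
next
  let ?w = "word_prod t n"
  fix c M assume M: "null_bmat (M * ?w - ?w * M)"
  have "scl c M * ?w - ?w * scl c M = scl c (M * ?w - ?w * M)"
    by (simp add: scale_diff_right)
  then show "null_bmat (scl c M * ?w - ?w * scl c M)"
    using null_bmat_scl[OF M] by simp
qed

lemma anti_word_prod:
  "m \<le> n \<Longrightarrow> null_bmat (anti n m * word_prod t n - word_prod t n * anti n m)"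
  unfolding anti_def by (rule asym_word_prod) force+

lemma rev_anti_word_prod:
  assumes "m \<le> n"
  shows "null_bmat (rev_anti n m * word_prod t n - word_prod t n * rev_anti n m)"
  unfolding rev_anti_def
proof (rule asym_word_prod)
  fix i assume "1 \<le> i" "i < m"
  then show "\<exists>l. 1 \<le> l \<and> l < n \<and> gen n (n - i) = gen n l"
    using assms by (intro exI[of _ "n - i"]) auto
qed fact

section \<open>The recursion for partial traces\<close>

definition sigma :: "nat \<Rightarrow> 'a" where
  "sigma m = (if m = 0 then 1 else \<phi> (q ^ m) * full_tr m (anti m m * word_prod t m))"

definition low :: "nat \<Rightarrow> 'n \<Rightarrow> 'n \<Rightarrow> 'a" where
  "low k = lower_tr k (chain k 1 k * word_prod t k)"

definition upp :: "nat \<Rightarrow> 'n \<Rightarrow> 'n \<Rightarrow> 'a" where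
  "upp k = upper_tr k (chain k 1 k * word_prod t k)"

lemma anti_expand:
  assumes "1 \<le> m" "m < n"
  shows "scl (qnum q (Suc m)) (anti n (Suc m))
    = scl (q ^ m) (anti n m) - scl (qnum q m) (anti n m * gen n m * anti n m)"
  using H.asym_Suc_Suc_expand[of "m - 1" n] H.asym_idem[of m n] assms by (simp add: anti_def)

lemma rev_anti_expand:
  assumes "1 \<le> m" "m < n"
  shows "scl (qnum q (Suc m)) (rev_anti n (Suc m))
    = scl (q ^ m) (rev_anti n m) - scl (qnum q m) (rev_anti n m * gen n (n - m) * rev_anti n m)"
proof -
  interpret rev: hecke scl q "unit_bmat n" "\<lambda>i. gen n (n - i)" n by (rule H.hecke_reverse)
  show ?thesis
    using rev.asym_Suc_Suc_expand[of "m - 1"] rev.asym_idem[of m] assms by (simp add: rev_anti_def)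
qed

text \<open>Moving the projector \<open>anti k m\<close> through \<open>T_1 \<dots> T_k\<close> and around the trace removes one of its
  two copies in the recursion for \<open>anti k (m + 1)\<close>.\<close>

lemma lower_step:
  fixes i j :: 'n
  assumes m: "1 \<le> m" "m < k"
  defines "F \<equiv> \<lambda>m. lower_tr k (anti k m * chain k m k * word_prod t k) i j"
  shows "\<phi> (qnum q (Suc m)) * F (Suc m) \<approx>\<^sub>I sigma m * low (k - m) i j - \<phi> (qnum q m) * F m"
proof -
  let ?a = "anti k m" and ?y = "gen k m" and ?W = "chain k (Suc m) k" and ?w = "word_prod t k"
  have F_m: "F m = lower_tr k (?a * ?y * ?W * ?w) i j"
    using m by (simp add: F_def chain_rec mult.assoc)
  have idem: "?a * ?a = ?a"
    using H.asym_idem[of m k] m by (simp add: anti_def)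
  have comm: "?a * ?W = ?W * ?a" using anti_chain m by simp
  \<comment> \<open>Since \<open>m < k\<close>, the projector lives in the traced copies 1,...,k-1
    and may be cycled.\<close>
  have a_tens: "?a = tens (k - 1) (anti (k - 1) m) (unit_bmat 1)"
    using anti_extend[of m "k - 1" k] m by simp
  have "?a * ?y * ?a * ?W * ?w = ?a * ?y * ?W * (?a * ?w)"
    by (simp only: mult.assoc comm)
  then have "?a * ?y * ?a * ?W * ?w - ?a * ?y * ?W * ?w * ?a = ?a * ?y * ?W * (?a * ?w - ?w * ?a)"
    by (simp add: right_diff_distrib mult.assoc)
  then have "lower_tr k (?a * ?y * ?a * ?W * ?w) i j \<approx>\<^sub>I lower_tr k (?a * ?y * ?W * ?w * ?a) i j"
    using m by (intro lower_tr_eqv) (simp add: null_bmat_times_left anti_word_prod)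
  also have "lower_tr k (?a * ?y * ?W * ?w * ?a) i j = lower_tr k (?a * (?a * ?y * ?W * ?w)) i j"
    by (subst (2 3) a_tens) (use m lower_tr_cyclic[of k "anti (k - 1) m"] in simp)
  also have "\<dots> = F m"
    unfolding F_m by (simp add: idem flip: mult.assoc)
  finally have aya: "lower_tr k (?a * ?y * ?a * ?W * ?w) i j \<approx>\<^sub>I F m" .
  let ?p = "k - m"
  have k: "m + ?p = k" using m by simp
  have "?a * ?W * ?w = tens m (anti m m * word_prod t m) (chain ?p 1 ?p * word_prod t ?p)"
  proof -
    have "homogeneous m (anti m m)" "homogeneous ?p (chain ?p 1 ?p)"
      by (simp add: anti_def homogeneous_iff_left) (simp add: homogeneous_chain)
    then have "?a * ?W = tens m (anti m m) (chain ?p 1 ?p)"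
      using anti_extend[of m m k] chain_shift[of m k] m
      by (simp add: tens_times_tens_central_left homogeneous_unit_left homogeneous_unit_right)
    moreover have "?w = tens m (word_prod t m) (word_prod t ?p)"
      using k by (simp add: tens_word_prod)
    ultimately show ?thesis by (simp add: tens_times_tens_central_left)
  qed
  then have fact: "\<phi> (q ^ m) * lower_tr k (?a * ?W * ?w) i j = sigma m * low ?p i j"
    using m by (simp add: lower_tr_tens[of ?p m, unfolded k] sigma_def low_def mult.assoc)
  have "\<phi> (qnum q (Suc m)) * F (Suc m)
      = lower_tr k (scl (qnum q (Suc m)) (anti k (Suc m)) * ?W * ?w) i j"
    by (simp add: F_def lower_tr_scl)
  also have "\<dots> = sigma m * low ?p i j - \<phi> (qnum q m) * lower_tr k (?a * ?y * ?a * ?W * ?w) i j"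
    by (simp add: anti_expand[OF m] left_diff_distrib lower_tr_diff lower_tr_scl fact)
  also have "\<dots> \<approx>\<^sub>I sigma m * low ?p i j - \<phi> (qnum q m) * F m"
    by (intro eqv_diff eqv_mult_left aya eqv_refl)
  finally show ?thesis .
qed

text \<open>The left projector can be cycled only from the front: it first commutes with
  \<open>?W\<close>. The right one has meanwhile passed T_1 ... T_k, so the two meet at the end and
  merge; a second use of the RTT relations returns the merged projector to its place.\<close>

lemma upper_step:
  fixes i j :: 'n
  assumes m: "1 \<le> m" "m < k"
  defines "G \<equiv> \<lambda>m. upper_tr k (chain k 1 (Suc (k - m)) * rev_anti k m * word_prod t k) i j"
  shows "\<phi> (qnum q (Suc m)) * G (Suc m) \<approx>\<^sub>I upp (k - m) i j * sigma m - \<phi> (qnum q m) * G m"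
proof -
  let ?p = "k - m"
  let ?b = "rev_anti k m" and ?y = "gen k ?p" and ?W = "chain k 1 ?p" and ?w = "word_prod t k"
  have k: "?p + m = k" using m by simp
  have chain: "chain k 1 (Suc ?p) = ?W * ?y" using m by (intro chain_Suc) auto
  have idem: "?b * ?b = ?b"
  proof -
    interpret rev: hecke scl q "unit_bmat k" "\<lambda>i. gen k (k - i)" k by (rule H.hecke_reverse)
    show ?thesis using rev.asym_idem[of m] m by (simp add: rev_anti_def)
  qed
  have comm: "?b * ?W = ?W * ?b" using rev_anti_chain m by simp
  \<comment> \<open>\<open>k - m\<close> is at least 1, so the untraced first copy can be split
    off.\<close>
  have b_tens: "?b = tens 1 (unit_bmat 1) (tens (?p - 1) (unit_bmat (?p - 1)) (anti m m))"
  proof -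
    have p: "1 + (?p - 1) = ?p" using m by simp
    have "?b = tens ?p (unit_bmat ?p) (anti m m)" using rev_anti_shift m by simp
    also have "\<dots> = tens (1 + (?p - 1)) (tens 1 (unit_bmat 1) (unit_bmat (?p - 1))) (anti m m)"
      by (simp only: tens_unit p)
    finally show ?thesis by (simp only: tens_assoc)
  qed
  have null: "null_bmat (?b * ?w - ?w * ?b)" using rev_anti_word_prod m by simp
  have "?W * ?b * ?y * ?b * ?w - ?W * ?b * ?y * ?w * ?b = ?W * ?b * ?y * (?b * ?w - ?w * ?b)"
    by (simp add: right_diff_distrib mult.assoc)
  then have "upper_tr k (?W * ?b * ?y * ?b * ?w) i j \<approx>\<^sub>I upper_tr k (?W * ?b * ?y * ?w * ?b) i j"
    by (intro upper_tr_eqv) (simp add: null_bmat_times_left null)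
  also have "?W * ?b * ?y * ?w * ?b = ?b * (?W * ?y * ?w * ?b)"
    by (simp only: mult.assoc flip: comm)
  also have "upper_tr k (?b * (?W * ?y * ?w * ?b)) i j = upper_tr k (?W * ?y * ?w * ?b * ?b) i j"
    by (subst (1 4) b_tens) (use m upper_tr_cyclic[of k "tens (?p - 1) (unit_bmat (?p - 1)) (anti m m)"] in simp)
  also have "\<dots> = upper_tr k (?W * ?y * (?w * ?b)) i j"
    by (simp add: idem mult.assoc)
  also have "\<dots> \<approx>\<^sub>I upper_tr k (?W * ?y * (?b * ?w)) i j"
    by (rule eqv_sym, rule upper_tr_eqv)
      (simp only: null_bmat_times_left[OF null] flip: right_diff_distrib)
  also have "\<dots> = G m"
    unfolding G_def chain by (simp add: mult.assoc)
  finally have byb: "upper_tr k (?W * ?b * ?y * ?b * ?w) i j \<approx>\<^sub>I G m" .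
  have "?W * ?b * ?w = tens ?p (chain ?p 1 ?p * word_prod t ?p) (anti m m * word_prod t m)"
  proof -
    have "homogeneous m (anti m m)" "homogeneous ?p (chain ?p 1 ?p)"
      by (simp add: anti_def homogeneous_iff_left) (simp add: homogeneous_chain)
    then have "?W * ?b = tens ?p (chain ?p 1 ?p) (anti m m)"
      using rev_anti_shift[of m k] chain_extend[of ?p k] m
      by (simp add: tens_times_tens_central_left homogeneous_unit_left homogeneous_unit_right)
    moreover have "?w = tens ?p (word_prod t ?p) (word_prod t m)"
      using k by (simp add: tens_word_prod)
    ultimately show ?thesis by (simp add: tens_times_tens_central_left)
  qed
  then have "\<phi> (q ^ m) * upper_tr k (?W * ?b * ?w) i j
      = \<phi> (q ^ m) * (upp ?p i j * full_tr m (anti m m * word_prod t m))"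
    using m by (simp add: upper_tr_tens[of ?p m, unfolded k] upp_def)
  also have "\<dots> = upp ?p i j * sigma m"
    using m by (simp add: sigma_def) (metis hom_central mult.assoc)
  finally have fact: "\<phi> (q ^ m) * upper_tr k (?W * ?b * ?w) i j = upp ?p i j * sigma m" .
  \<comment> \<open>The chain in \<open>G (Suc m)\<close> ends at R_{k-m-1}, one generator earlier
    than in \<open>G m\<close>; it is the full chain of the first k-m copies.\<close>
  have "Suc (k - Suc m) = ?p" using m by simp
  then have "\<phi> (qnum q (Suc m)) * G (Suc m)
      = upper_tr k (?W * scl (qnum q (Suc m)) (rev_anti k (Suc m)) * ?w) i j"
    by (simp add: G_def upper_tr_scl)
  also have "\<dots> = upp ?p i j * sigma m - \<phi> (qnum q m) * upper_tr k (?W * ?b * ?y * ?b * ?w) i j"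
    by (simp add: rev_anti_expand[OF m] left_diff_distrib right_diff_distrib upper_tr_diff
        upper_tr_scl fact[unfolded mult.assoc One_nat_def] mult.assoc)
  also have "\<dots> \<approx>\<^sub>I upp ?p i j * sigma m - \<phi> (qnum q m) * G m"
    by (intro eqv_diff eqv_mult_left byb eqv_refl)
  finally show ?thesis .
qed

text \<open>Unrolling the recursion flips the sign at each step. The outer minus makes the last
  summand, \<open>l = k - 1\<close>, enter positively.\<close>

lemma alternating_sum:
  assumes "F 1 \<approx>\<^sub>I Y 0" and "\<And>m. 1 \<le> m \<Longrightarrow> m < k \<Longrightarrow> F (Suc m) \<approx>\<^sub>I Y m - F m" and "1 \<le> k"
  shows "F k \<approx>\<^sub>I - (\<Sum>l\<in>{0..k - 1}. \<phi> ((- 1) ^ (k - l)) * Y l)"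
proof -
  have *: "1 \<le> m \<Longrightarrow> m \<le> k \<Longrightarrow> F m \<approx>\<^sub>I - (\<Sum>l<m. \<phi> ((- 1) ^ (m - l)) * Y l)" for m
  proof (induction m)
    case (Suc m)
    show ?case
    proof (cases "m = 0")
      case True
      then show ?thesis using assms(1) by (simp add: hom_minus)
    next
      case False
      then have "F (Suc m) \<approx>\<^sub>I Y m - F m" using assms(2) Suc by simp
      also have "Y m - F m \<approx>\<^sub>I Y m - - (\<Sum>l<m. \<phi> ((- 1) ^ (m - l)) * Y l)"
        using False Suc by (intro eqv_diff) auto
      also have "\<dots> = - (\<Sum>l<Suc m. \<phi> ((- 1) ^ (Suc m - l)) * Y l)"
        by (simp add: hom_minus Suc_diff_le sum_negf)
      finally show ?thesis .
    qed
  qed simp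
  have "{0..k - 1} = {..<k}" using assms(3) by auto
  then show ?thesis using *[of k] assms(3) by (simp only: order_refl)
qed

lemma lower_newton:
  assumes "1 \<le> k"
  shows "\<phi> (qnum q k) * lower_tr k (anti k k * word_prod t k) i j
    \<approx>\<^sub>I - (\<Sum>m\<in>{0..k - 1}. \<phi> ((- 1) ^ (k - m)) * (sigma m * low (k - m) i j))"
proof -
  \<comment> \<open>Including the q-number makes the recursion coefficient-free. At
    \<open>m = 1\<close> the antisymmetrizer is the identity and the chain is full, giving the k-th
    power; at \<open>m = k\<close> the chain is empty.\<close>
  define F where "F m = \<phi> (qnum q m) * lower_tr k (anti k m * chain k m k * word_prod t k) i j" for m
  have "F k \<approx>\<^sub>I - (\<Sum>m\<in>{0..k - 1}. \<phi> ((- 1) ^ (k - m)) * (sigma m * low (k - m) i j))"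
  proof (rule alternating_sum)
    show "F 1 \<approx>\<^sub>I sigma 0 * low (k - 0) i j"
      by (simp add: F_def sigma_def low_def anti_def homogeneous_unit_left homogeneous_chain)
    show "F (Suc m) \<approx>\<^sub>I sigma m * low (k - m) i j - F m" if "1 \<le> m" "m < k" for m
      using lower_step[OF that] that by (simp add: F_def sigma_def)
  qed fact
  moreover have "anti k k * unit_bmat k = anti k k"
    by (simp add: anti_def)
  ultimately show ?thesis by (simp add: F_def)
qed

lemma upper_newton:
  assumes "1 \<le> k"
  shows "\<phi> (qnum q k) * upper_tr k (anti k k * word_prod t k) i j
    \<approx>\<^sub>I - (\<Sum>m\<in>{0..k - 1}. \<phi> ((- 1) ^ (k - m)) * (upp (k - m) i j * sigma m))"
proof -
  define G where "G m = \<phi> (qnum q m) *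
    upper_tr k (chain k 1 (Suc (k - m)) * rev_anti k m * word_prod t k) i j" for m
  have "G k \<approx>\<^sub>I - (\<Sum>m\<in>{0..k - 1}. \<phi> ((- 1) ^ (k - m)) * (upp (k - m) i j * sigma m))"
  proof (rule alternating_sum)
    have "homogeneous k (chain k 1 k)" by (simp add: homogeneous_chain)
    then show "G 1 \<approx>\<^sub>I upp (k - 0) i j * sigma 0"
      using assms by (simp add: G_def sigma_def upp_def rev_anti_def homogeneous_unit_right)
    show "G (Suc m) \<approx>\<^sub>I upp (k - m) i j * sigma m - G m" if "1 \<le> m" "m < k" for m
      using upper_step[OF that] that by (simp add: G_def sigma_def)
  qed fact
  \<comment> \<open>The chain in \<open>G k\<close> is empty, and \<open>rev_anti_full\<close> turns
    the mirrored antisymmetrizer into the one in the claim.\<close>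
  moreover have "unit_bmat k * anti k k = anti k k"
    by (simp add: anti_def)
  ultimately show ?thesis by (simp add: G_def rev_anti_full)
qed

end


section \<open>Passage to the RTT-algebra\<close>

lemma ring_of_type_algebra_simps [simp]:
  "carrier ring_of_type_algebra = UNIV" "x \<otimes>\<^bsub>ring_of_type_algebra\<^esub> y = x * y"
  "x \<oplus>\<^bsub>ring_of_type_algebra\<^esub> y = x + y" "\<one>\<^bsub>ring_of_type_algebra\<^esub> = 1"
  "\<zero>\<^bsub>ring_of_type_algebra\<^esub> = 0"
  for x y :: "'a::ring_1"
  by (simp_all add: ring_of_type_algebra_def)

lemma ring_ring_of_type_algebra: "ring (ring_of_type_algebra :: 'a::ring_1 ring)"
proof -
  have "\<exists>y. x + y = 0" for x :: 'a
    using add.right_inverse by blast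
  then show ?thesis
    unfolding ring_of_type_algebra_def using add.right_inverse
    by unfold_locales (auto simp: algebra_simps Units_def)
qed

lemma finsum_ring_of_type_algebra [simp]:
  "finsum (ring_of_type_algebra :: 'a::ring_1 ring) f A = sum f A"
proof -
  interpret ring "ring_of_type_algebra :: 'a ring" by (rule ring_ring_of_type_algebra)
  show ?thesis
    by (induction A rule: infinite_finite_induct) (auto simp: finsum_infinite)
qed

lemma a_inv_ring_of_type_algebra [simp]:
  "\<ominus>\<^bsub>ring_of_type_algebra\<^esub> x = - (x :: 'a::ring_1)"
proof -
  interpret ring "ring_of_type_algebra :: 'a ring" by (rule ring_ring_of_type_algebra)
  show ?thesis by (rule minus_equality) auto
qed

text \<open>Convolution with an element supported on the empty word acts coefficientwise. Comparing
  both sides shows that scalars are central, the field being commutative.\<close>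

lemma
  fixes x :: "('x, 'k::ring_1) free_algebra"
  shows free_scalar_mult: "Poly_Mapping.lookup (free_scalar c * x) w = c * Poly_Mapping.lookup x w"
    and mult_free_scalar: "Poly_Mapping.lookup (x * free_scalar c) w = Poly_Mapping.lookup x w * c"
proof -
  have l: "Sum_any (\<lambda>v. Poly_Mapping.lookup x v when w = l + v) = Poly_Mapping.lookup x w" if "l = 0" for l :: "'x fmonoid"
    using that by simp
  have "Poly_Mapping.lookup (free_scalar c * x) w = Sum_any (\<lambda>l::'x fmonoid. (c * Poly_Mapping.lookup x w) when l = 0)"
    unfolding lookup_mult free_scalar_def
    by (intro arg_cong[where f = Sum_any] ext) (auto simp: lookup_single when_def l)
  then show "Poly_Mapping.lookup (free_scalar c * x) w = c * Poly_Mapping.lookup x w" by simp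
  have r: "Sum_any (\<lambda>v. (c when 0 = v) when w = l + v) = (c when l = w)" for l :: "'x fmonoid"
  proof -
    have "Sum_any (\<lambda>v. (c when 0 = v) when w = l + v) = Sum_any (\<lambda>v::'x fmonoid. (c when l = w) when v = 0)"
      by (intro arg_cong[where f = Sum_any] ext) (auto simp: when_def)
    then show ?thesis by simp
  qed
  have "Poly_Mapping.lookup (x * free_scalar c) w = Sum_any (\<lambda>l. (Poly_Mapping.lookup x l * c) when l = w)"
    unfolding lookup_mult free_scalar_def lookup_single r
    by (intro arg_cong[where f = Sum_any] ext) (auto simp: when_def)
  then show "Poly_Mapping.lookup (x * free_scalar c) w = Poly_Mapping.lookup x w * c" by simp
qed

interpretation free_scalar: scalar_hom "free_scalar :: 'k::field \<Rightarrow> ('x, 'k) free_algebra"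
proof
  fix c d :: 'k and x :: "('x, 'k) free_algebra"
  show "free_scalar (c + d) = (free_scalar c + free_scalar d :: ('x, 'k) free_algebra)"
    by (simp add: free_scalar_def single_add)
  show "free_scalar (c * d) = (free_scalar c * free_scalar d :: ('x, 'k) free_algebra)"
    by (simp add: free_scalar_def mult_single)
  show "free_scalar 1 = (1 :: ('x, 'k) free_algebra)"
    by (simp add: free_scalar_def)
  show "free_scalar c * x = x * free_scalar c"
    by (rule poly_mapping_eqI) (simp add: free_scalar_mult mult_free_scalar mult.commute)
qed

lemma of_tmat_cong:
  "(\<And>a b. length a = n \<Longrightarrow> length b = n \<Longrightarrow> f a b = g a b) \<Longrightarrow> of_tmat n f = of_tmat n g"
  by (auto intro!: bmat_eqI)

lemma of_tmat_tone: "of_tmat n (tone ring_of_type_algebra) = unit_bmat n"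
  by (auto intro!: bmat_eqI simp: tone_def)

lemma of_tmat_tmult:
  fixes f g :: "('n::finite, 'a::ring_1) tmat"
  shows "of_tmat n (tmult ring_of_type_algebra n f g) = of_tmat n f * of_tmat n g"
  by (rule bmat_eqI) (auto simp: tmult_def entry_times intro: sum.cong)

lemma of_tmat_tprod:
  fixes Ms :: "('n::finite, 'a::ring_1) tmat list"
  shows "of_tmat n (tprod ring_of_type_algebra n Ms) = foldr (\<lambda>M N. of_tmat n M * N) Ms (unit_bmat n)"
  by (induction Ms) (simp_all add: tprod_def of_tmat_tone of_tmat_tmult)

lemma of_tmat_acting_at:
  fixes M :: "('n::finite, 'a::ring_1) tmat"
  assumes "i - 1 + m \<le> n"
  shows "of_tmat n (acting_at ring_of_type_algebra i m M)
    = tens (i - 1) (unit_bmat (i - 1)) (tens m (of_tmat m M) (unit_bmat (n - (i - 1 + m))))"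
proof (rule bmat_eqI)
  fix a b :: "'n list" assume len: "length a = length b"
  obtain p where p: "i - 1 = p" by simp
  show "entry (of_tmat n (acting_at ring_of_type_algebra i m M)) a b = entry (tens (i - 1)
      (unit_bmat (i - 1)) (tens m (of_tmat m M) (unit_bmat (n - (i - 1 + m))))) a b"
    using assms len unfolding acting_at_def p
    by (cases "length a = n") (auto simp: entry_tens add.commute[of m p])
qed

lemma word_prod_Suc_0: "word_prod t (Suc 0) = of_tmat (Suc 0) (one_copy t)"
  by (rule bmat_eqI) (auto simp: word_prod_def one_copy_def length_Suc_conv)

lemma of_tmat_T_at:
  fixes t :: "'n::finite \<Rightarrow> 'n \<Rightarrow> 'a::ring_1"
  assumes "1 \<le> i" "i \<le> n"
  shows "of_tmat n (T_at ring_of_type_algebra t i)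
    = tens (i - 1) (unit_bmat (i - 1)) (tens 1 (word_prod t 1) (unit_bmat (n - i)))"
  using of_tmat_acting_at[of i 1 n "one_copy t"] assms
  by (simp add: T_at_def flip: word_prod_Suc_0)

text \<open>Each new T_{p+1} meets an identity in its own copy, so the interchange law applies
  although the entries of \<open>T\<close> do not commute, and the written order is
  preserved.\<close>

lemma foldr_T_at:
  fixes t :: "'n::finite \<Rightarrow> 'n \<Rightarrow> 'a::ring_1"
  assumes "p \<le> n"
  shows "foldr (\<lambda>M N. of_tmat n M * N) (map (T_at ring_of_type_algebra t) [Suc p..<Suc n]) (unit_bmat n)
    = tens p (unit_bmat p) (word_prod t (n - p))"
  using assms
proof (induction p rule: inc_induct)
  case base
  have "word_prod t 0 = unit_bmat 0"
    by (rule bmat_eqI) (auto simp: word_prod_def)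
  then show ?case by (simp add: tens_unit)
next
  case (step p)
  have p: "p + 1 = Suc p" by simp
  have n: "1 + (n - Suc p) = n - p" using step by simp
  have "foldr (\<lambda>M N. of_tmat n M * N) (map (T_at ring_of_type_algebra t) [Suc p..<Suc n]) (unit_bmat n)
      = of_tmat n (T_at ring_of_type_algebra t (Suc p))
        * tens (Suc p) (unit_bmat (Suc p)) (word_prod t (n - Suc p))"
    using step by (simp add: upt_conv_Cons[of "Suc p"] del: upt_Suc)
  also have "tens (Suc p) (unit_bmat (Suc p)) (word_prod t (n - Suc p))
      = tens p (unit_bmat p) (tens 1 (unit_bmat 1) (word_prod t (n - Suc p)))"
    by (simp only: tens_assoc p tens_unit)
  also have "of_tmat n (T_at ring_of_type_algebra t (Suc p)) * \<dots>
      = tens p (unit_bmat p) (tens 1 (word_prod t 1) (word_prod t (n - Suc p)))"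
    using of_tmat_T_at[of "Suc p" n t] step
    by (simp add: tens_times_tens_central_left tens_times_tens_central_right
        homogeneous_unit_left homogeneous_unit_right)
  also have "\<dots> = tens p (unit_bmat p) (word_prod t (n - p))"
    by (simp only: tens_word_prod n)
  finally show ?case .
qed

lemma foldr_all_T_at:
  fixes t :: "'n::finite \<Rightarrow> 'n \<Rightarrow> 'a::ring_1"
  shows "foldr (\<lambda>M N. of_tmat n M * N) (map (T_at ring_of_type_algebra t) [1..<n + 1]) (unit_bmat n)
    = word_prod t n"
  using foldr_T_at[of 0 n t] by (simp add: tens_unit_0_left[of n])

context scalar_hom
begin

definition hom_tmat :: "('n, 'k) tmat \<Rightarrow> ('n, 'a) tmat" where
  "hom_tmat M = (\<lambda>a b. \<phi> (M a b))"

lemma hom_tmat_tone: "hom_tmat (tone ring_of_type_algebra) = tone ring_of_type_algebra"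
  by (intro ext) (auto simp: hom_tmat_def tone_def)

lemma hom_tmat_acting_at:
  "hom_tmat (acting_at ring_of_type_algebra i m M) = acting_at ring_of_type_algebra i m (hom_tmat M)"
  by (intro ext) (auto simp: hom_tmat_def acting_at_def)

lemma hom_tmat_tmult:
  "hom_tmat (tmult ring_of_type_algebra n M N)
    = tmult ring_of_type_algebra n (hom_tmat M) (hom_tmat N)"
  by (auto simp: hom_tmat_def tmult_def hom_sum hom_mult)

lemma hom_tmat_tprod:
  "hom_tmat (tprod ring_of_type_algebra n Ms) = tprod ring_of_type_algebra n (map hom_tmat Ms)"
  by (induction Ms) (simp_all add: tprod_def hom_tmat_tone hom_tmat_tmult)

definition matrix_bmat :: "'k ^ ('n::finite \<times> 'n) ^ ('n \<times> 'n) \<Rightarrow> ('n, 'a) bmat" where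
  "matrix_bmat M = of_tmat 2 (hom_tmat (tmat_of M))"

lemma matrix_bmat_mult: "matrix_bmat (M ** N) = matrix_bmat M * matrix_bmat N"
proof (rule bmat_eqI)
  fix a b :: "'b list" assume "length a = length b"
  show "entry (matrix_bmat (M ** N)) a b = entry (matrix_bmat M * matrix_bmat N) a b"
  proof (cases "length a = 2")
    case True
    have "(\<Sum>z\<in>UNIV. g z) = (\<Sum>i\<in>UNIV. \<Sum>j\<in>UNIV. g (i, j))" for g :: "'b \<times> 'b \<Rightarrow> 'a"
      by (simp add: sum.cartesian_product)
    then show ?thesis
      using True \<open>length a = length b\<close>
      by (simp add: matrix_bmat_def hom_tmat_def tmat_of_def matrix_matrix_mult_def entry_times
          hom_sum hom_mult numeral_2_eq_2 sum_multi_indices_Suc)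
  qed (simp add: matrix_bmat_def entry_times)
qed

lemma matrix_bmat_diff: "matrix_bmat (M - N) = matrix_bmat M - matrix_bmat N"
  and matrix_bmat_add: "matrix_bmat (M + N) = matrix_bmat M + matrix_bmat N"
  by (auto intro!: bmat_eqI simp: matrix_bmat_def hom_tmat_def tmat_of_def hom_diff hom_add)

lemma matrix_bmat_mat: "matrix_bmat (mat c) = scl c (unit_bmat 2)"
  by (rule bmat_eqI)
    (auto simp: matrix_bmat_def hom_tmat_def tmat_of_def mat_def numeral_2_eq_2 length_Suc_conv)

lemma central_of_tmat_hom [simp]: "central_entries (of_tmat n (hom_tmat M))"
  by (auto simp: central_entries_def hom_tmat_def hom_central)

lemma of_tmat_R_at:
  fixes R :: "'k ^ ('n::finite \<times> 'n) ^ ('n \<times> 'n)"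
  assumes "1 \<le> i" "i < n"
  shows "of_tmat n (hom_tmat (R_at R i))
    = tens (i - 1) (unit_bmat (i - 1)) (tens 2 (matrix_bmat R) (unit_bmat (n - i - 1)))"
proof -
  have "n - (i - 1 + 2) = n - i - 1" using assms by simp
  then show ?thesis
    using assms of_tmat_acting_at[of i 2 n "hom_tmat (tmat_of R)"]
    by (simp add: R_at_def hom_tmat_acting_at matrix_bmat_def)
qed

lemma hecke_matrix_of_hecke_type:
  fixes R :: "'k ^ ('n::finite \<times> 'n) ^ ('n \<times> 'n)"
  assumes "q_generic q" "yang_baxter R" "hecke_type q R"
  shows "hecke_matrix \<phi> q (matrix_bmat R)"
proof -
  interpret q_generic q by fact
  have hom: "homogeneous 2 (matrix_bmat R)" by (simp add: matrix_bmat_def)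
  have R_3: "of_tmat 3 (hom_tmat (R_at R 1)) = tens 2 (matrix_bmat R) (unit_bmat 1)"
    "of_tmat 3 (hom_tmat (R_at R 2)) = tens 1 (unit_bmat 1) (matrix_bmat R)"
    using of_tmat_R_at[of 1 3 R] of_tmat_R_at[of 2 3 R]
      tens_unit_0_left[OF homogeneous_tens[OF hom homogeneous_unit, of 1]] tens_unit_0_right[OF hom]
    by simp_all
  show ?thesis
  proof
    show "homogeneous 2 (matrix_bmat R)" by fact
    show "central_entries (matrix_bmat R)" by (simp add: matrix_bmat_def)
    have "matrix_bmat ((R - mat q) ** (R + mat (inverse q))) = 0"
      using assms(3) by (auto intro!: bmat_eqI simp: hecke_type_def matrix_bmat_def hom_tmat_def tmat_of_def)
    then show "(matrix_bmat R - scl q (unit_bmat 2)) * (matrix_bmat R + scl (inverse q) (unit_bmat 2)) = 0"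
      by (simp add: matrix_bmat_mult matrix_bmat_diff matrix_bmat_add matrix_bmat_mat)
    let ?R = "hom_tmat (R_at R 1)" and ?R' = "hom_tmat (R_at R 2)"
    \<comment> \<open>The Yang-Baxter equation is assumed on words of length 3 only, exactly those
      that \<open>of_tmat 3\<close> retains.\<close>
    have "of_tmat 3 (hom_tmat (tprod ring_of_type_algebra 3 [R_at R 1, R_at R 2, R_at R 1]))
        = of_tmat 3 (hom_tmat (tprod ring_of_type_algebra 3 [R_at R 2, R_at R 1, R_at R 2]))"
      using assms(2) by (intro of_tmat_cong) (simp add: yang_baxter_def hom_tmat_def)
    then have "of_tmat 3 ?R * (of_tmat 3 ?R' * (of_tmat 3 ?R * unit_bmat 3))
        = of_tmat 3 ?R' * (of_tmat 3 ?R * (of_tmat 3 ?R' * unit_bmat 3))"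
      by (simp add: hom_tmat_tprod of_tmat_tprod)
    then have "of_tmat 3 ?R * of_tmat 3 ?R' * of_tmat 3 ?R = of_tmat 3 ?R' * of_tmat 3 ?R * of_tmat 3 ?R'"
      by (simp add: homogeneous_unit_right mult.assoc)
    then show "tens 2 (matrix_bmat R) (unit_bmat 1) * tens 1 (unit_bmat 1) (matrix_bmat R)
          * tens 2 (matrix_bmat R) (unit_bmat 1)
        = tens 1 (unit_bmat 1) (matrix_bmat R) * tens 2 (matrix_bmat R) (unit_bmat 1)
          * tens 1 (unit_bmat 1) (matrix_bmat R)"
      by (simp only: R_3)
  qed
qed

text \<open>The defining recursion enlarges the tensor power at every step, while
  \<open>anti n\<close> stays on a fixed one; \<open>anti_extend\<close> reconciles the two.\<close>

lemma of_tmat_antisymmetrizer: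
  fixes R :: "'k ^ ('n::finite \<times> 'n) ^ ('n \<times> 'n)"
  assumes "hecke_matrix \<phi> q (matrix_bmat R)"
  shows "of_tmat m (hom_tmat (antisymmetrizer q R m)) = hecke_matrix.anti \<phi> q (matrix_bmat R) m m"
proof -
  interpret hecke_matrix \<phi> q "matrix_bmat R" by fact
  show ?thesis
  proof (induction m rule: less_induct)
    case (less m)
    consider "m = 0" | "m = Suc 0" | l where "m = Suc (Suc l)"
      by (metis not0_implies_Suc)
    then show ?case
    proof cases
      case 3
      let ?n = "l + 2" and ?S = "ring_of_type_algebra :: 'k ring"
      let ?A = "acting_at ?S 1 (l + 1) (antisymmetrizer q R (Suc l))"
      let ?B = "\<lambda>a b. q ^ (l + 1) * tone ?S a b - qnum q (l + 1) * R_at R (l + 1) a b"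
      have A: "of_tmat ?n (hom_tmat ?A) = anti ?n (l + 1)"
      proof -
        have "of_tmat ?n (hom_tmat ?A)
            = tens 0 (unit_bmat 0) (tens (l + 1) (anti (l + 1) (l + 1)) (unit_bmat 1))"
          unfolding hom_tmat_acting_at
          using of_tmat_acting_at[of 1 "l + 1" ?n "hom_tmat (antisymmetrizer q R (Suc l))"] less 3
          by simp
        moreover have "anti ?n (l + 1) = tens (l + 1) (anti (l + 1) (l + 1)) (unit_bmat 1)"
          using anti_extend[of "l + 1" "l + 1" ?n] by simp
        moreover have "homogeneous ?n (anti ?n (l + 1))"
          by (simp add: homogeneous_iff_left anti_def)
        ultimately show ?thesis by (simp add: tens_unit_0_left)
      qed
      have B: "of_tmat ?n (hom_tmat ?B) = scl (q ^ (l + 1)) (unit_bmat ?n) - scl (qnum q (l + 1)) (gen ?n (l + 1))"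
      proof -
        have "of_tmat ?n (hom_tmat ?B) = scl (q ^ (l + 1)) (unit_bmat ?n)
            - scl (qnum q (l + 1)) (of_tmat ?n (hom_tmat (R_at R (l + 1))))"
          by (auto intro!: bmat_eqI simp: hom_tmat_def tone_def hom_diff hom_mult)
        then show ?thesis
          using of_tmat_R_at[of "l + 1" ?n R] by (simp add: gen_def)
      qed
      have "of_tmat m (hom_tmat (antisymmetrizer q R m))
          = scl (1 / qnum q ?n) (of_tmat ?n (hom_tmat (tprod ?S ?n [?A, ?B, ?A])))"
        using 3 by (auto intro!: bmat_eqI simp: hom_tmat_def Let_def simp flip: hom_mult)
      also have "\<dots> = scl (1 / qnum q ?n) (anti ?n (l + 1)
          * (scl (q ^ (l + 1)) (unit_bmat ?n) - scl (qnum q (l + 1)) (gen ?n (l + 1)))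
          * anti ?n (l + 1))"
        unfolding hom_tmat_tprod of_tmat_tprod list.map foldr_Cons foldr_Nil o_apply id_apply A B
        by (simp add: anti_def mult.assoc)
      also have "\<dots> = anti m m"
        using 3 by (simp add: anti_def asym.simps(3))
      finally show ?thesis .
    qed (auto simp: anti_def hom_tmat_tone of_tmat_tone)
  qed
qed

end

section \<open>The quotient by the RTT relations\<close>

lemma ideal_rtt_ideal: "ideal (rtt_ideal R) ring_of_type_algebra"
  unfolding rtt_ideal_def by (rule ring.genideal_ideal[OF ring_ring_of_type_algebra]) simp

definition rtt_proj :: "'k::field ^ ('n::finite \<times> 'n) ^ ('n \<times> 'n)
    \<Rightarrow> ('n \<times> 'n, 'k) free_algebra \<Rightarrow> ('n \<times> 'n, 'k) free_algebra set" where
  "rtt_proj R x = rtt_ideal R +>\<^bsub>ring_of_type_algebra\<^esub> x"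

lemma ring_hom_rtt_proj: "ring_hom_ring ring_of_type_algebra (rtt_algebra R) (rtt_proj R)"
  using ideal.rcos_ring_hom_ring[OF ideal_rtt_ideal[of R]]
  by (simp add: rtt_algebra_def rtt_proj_def[abs_def])

lemma rtt_proj_mult: "rtt_proj R x \<otimes>\<^bsub>rtt_algebra R\<^esub> rtt_proj R y = rtt_proj R (x * y)"
  and rtt_proj_one: "\<one>\<^bsub>rtt_algebra R\<^esub> = rtt_proj R 1"
  and rtt_proj_zero: "\<zero>\<^bsub>rtt_algebra R\<^esub> = rtt_proj R 0"
  and rtt_proj_uminus: "\<ominus>\<^bsub>rtt_algebra R\<^esub> rtt_proj R x = rtt_proj R (- x)"
  and rtt_proj_sum: "(\<Oplus>\<^bsub>rtt_algebra R\<^esub>c\<in>A. rtt_proj R (f c)) = rtt_proj R (sum f A)"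
proof -
  interpret ring_hom_ring ring_of_type_algebra "rtt_algebra R" "rtt_proj R"
    by (rule ring_hom_rtt_proj)
  show "rtt_proj R x \<otimes>\<^bsub>rtt_algebra R\<^esub> rtt_proj R y = rtt_proj R (x * y)"
    using hom_mult[of x y] by simp
  show "\<one>\<^bsub>rtt_algebra R\<^esub> = rtt_proj R 1" using hom_one by simp
  show "\<zero>\<^bsub>rtt_algebra R\<^esub> = rtt_proj R 0" using hom_zero by simp
  show "\<ominus>\<^bsub>rtt_algebra R\<^esub> rtt_proj R x = rtt_proj R (- x)" using hom_a_inv[of x] by simp
  show "(\<Oplus>\<^bsub>rtt_algebra R\<^esub>c\<in>A. rtt_proj R (f c)) = rtt_proj R (sum f A)"
    using hom_finsum[of f A] by (simp add: comp_def)
qed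

lemma rtt_proj_eqI:
  assumes "x - y \<in> rtt_ideal R"
  shows "rtt_proj R x = rtt_proj R y"
  using assms ring.quotient_eq_iff_same_a_r_cos[OF ring_ring_of_type_algebra ideal_rtt_ideal, of x y R]
  by (simp add: rtt_proj_def a_minus_def)

definition proj_tmat :: "'k::field ^ ('n::finite \<times> 'n) ^ ('n \<times> 'n) \<Rightarrow> ('n, ('n \<times> 'n, 'k) free_algebra) tmat
    \<Rightarrow> ('n, ('n \<times> 'n, 'k) free_algebra set) tmat" where
  "proj_tmat R M = (\<lambda>a b. rtt_proj R (M a b))"

text \<open>The projection is a ring homomorphism, so products in the RTT-algebra can be computed on
  representatives.\<close>

lemma tprod_proj_tmat:
  "tprod (rtt_algebra R) n (map (proj_tmat R) Ms) = proj_tmat R (tprod ring_of_type_algebra n Ms)"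
proof (induction Ms)
  case Nil
  show ?case
    by (intro ext) (simp add: tprod_def proj_tmat_def tone_def rtt_proj_one rtt_proj_zero)
next
  case (Cons M Ms)
  then show ?case
    by (simp add: tprod_def tmult_def proj_tmat_def rtt_proj_mult rtt_proj_sum)
qed

lemma ptrace_proj_tmat:
  "ptrace (rtt_algebra R) i j (proj_tmat R M) a b = rtt_proj R (ptrace ring_of_type_algebra i j M a b)"
  by (simp add: ptrace_def proj_tmat_def rtt_proj_sum)

abbreviation free_T :: "'n \<Rightarrow> 'n \<Rightarrow> ('n \<times> 'n, 'k::field) free_algebra" where
  "free_T \<equiv> (\<lambda>i j. free_gen (i, j))"

lemma T_at_proj_tmat:
  "T_at (rtt_algebra R) (rtt_T R) = (\<lambda>i. proj_tmat R (T_at ring_of_type_algebra free_T i))"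
  by (intro ext) (simp add: T_at_def acting_at_def one_copy_def rtt_T_def proj_tmat_def
      rtt_proj_zero flip: rtt_proj_def)

lemma rtt_tmat_proj_tmat: "rtt_tmat R M = proj_tmat R (free_scalar.hom_tmat M)"
  by (simp add: rtt_tmat_def rtt_scalar_def proj_tmat_def free_scalar.hom_tmat_def rtt_proj_def)

lemma rtt_scalar_proj: "rtt_scalar R c = rtt_proj R (free_scalar c)"
  by (simp add: rtt_scalar_def rtt_proj_def)

context
  fixes q :: "'k::field" and R :: "'k ^ ('n::finite \<times> 'n) ^ ('n \<times> 'n)"
  assumes q: "q_generic q" and yb: "yang_baxter R" and hecke_R: "hecke_type q R"
begin

abbreviation free_R :: "('n, ('n \<times> 'n, 'k) free_algebra) bmat" where
  "free_R \<equiv> free_scalar.matrix_bmat R"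

lemma hecke_free_R: "hecke_matrix free_scalar q free_R"
  using q yb hecke_R by (rule free_scalar.hecke_matrix_of_hecke_type)

lemma rtt_free_R: "rtt_matrix free_scalar q free_R free_T (rtt_ideal R)"
proof -
  interpret hecke_matrix free_scalar q free_R by (rule hecke_free_R)
  interpret I: ideal "rtt_ideal R" ring_of_type_algebra by (rule ideal_rtt_ideal)
  have zero: "0 \<in> rtt_ideal R"
    using additive_subgroup.zero_closed[OF ideal.axioms(1)[OF ideal_rtt_ideal]] by simp
  show ?thesis
  proof
    show "0 \<in> rtt_ideal R" by fact
    show "x + y \<in> rtt_ideal R" if "x \<in> rtt_ideal R" "y \<in> rtt_ideal R" for x y
      using additive_subgroup.a_closed[OF ideal.axioms(1)[OF ideal_rtt_ideal] that] by simp
    show "z * x \<in> rtt_ideal R" "x * z \<in> rtt_ideal R" if "x \<in> rtt_ideal R" for x z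
      using I.I_l_closed[OF that, of z] I.I_r_closed[OF that, of z] by simp_all
    let ?T = "\<lambda>i. T_at ring_of_type_algebra free_T i"
    let ?R = "free_scalar.hom_tmat (tmat_of R)"
    let ?w = "word_prod free_T 2"
    fix a b :: "'n list"
    have T: "of_tmat 2 (?T 1) * (of_tmat 2 (?T 2) * unit_bmat 2) = ?w"
      using foldr_all_T_at[of 2 free_T] by (simp add: upt_rec numeral_2_eq_2)
    then have T': "of_tmat 2 (?T 1) * of_tmat 2 (?T 2) = ?w"
      by (simp add: homogeneous_unit_right)
    have left: "of_tmat 2 (tprod ring_of_type_algebra 2 [?R, ?T 1, ?T 2]) = free_R * ?w"
      by (simp add: of_tmat_tprod free_scalar.matrix_bmat_def T[simplified])
    have right: "of_tmat 2 (tprod ring_of_type_algebra 2 [?T 1, ?T 2, ?R]) = ?w * free_R"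
      by (simp add: of_tmat_tprod free_scalar.matrix_bmat_def homogeneous_unit_right
          flip: T'[simplified] mult.assoc)
    have entry: "entry (free_R * ?w - ?w * free_R) a b
        = (if length a = 2 \<and> length b = 2 then tprod ring_of_type_algebra 2 [?R, ?T 1, ?T 2] a b
          - tprod ring_of_type_algebra 2 [?T 1, ?T 2, ?R] a b else 0)"
      unfolding left[symmetric] right[symmetric] entry_minus entry_of_tmat by simp
    \<comment> \<open>Words of length 2 give the generating relations; on all other words the entry
      is 0, which also lies in the ideal.\<close>
    have "rtt_relations R \<subseteq> rtt_ideal R"
      unfolding rtt_ideal_def by (rule ring.genideal_self[OF ring_ring_of_type_algebra]) simp
    then show "entry (free_R * ?w - ?w * free_R) a b \<in> rtt_ideal R"
      unfolding entry using zero
      by (auto simp: rtt_relations_def Let_def free_scalar.hom_tmat_def)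
  qed
qed

interpretation rtt_matrix free_scalar q free_R free_T "rtt_ideal R"
  by (rule rtt_free_R)

lemma rtt_proj_eqv: "eqv x y \<Longrightarrow> rtt_proj R x = rtt_proj R y"
  unfolding eqv_def by (rule rtt_proj_eqI)

definition free_A :: "nat \<Rightarrow> ('n, ('n \<times> 'n, 'k) free_algebra) tmat" where
  "free_A k = tprod ring_of_type_algebra k (free_scalar.hom_tmat (antisymmetrizer q R k)
     # map (T_at ring_of_type_algebra free_T) [1..<k + 1])"

definition free_RT :: "nat \<Rightarrow> ('n, ('n \<times> 'n, 'k) free_algebra) tmat" where
  "free_RT k = tprod ring_of_type_algebra k (map (\<lambda>i. free_scalar.hom_tmat (R_at R i)) [1..<k]
     @ map (T_at ring_of_type_algebra free_T) [1..<k + 1])"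

lemma A_T_proj: "A_T q R k = proj_tmat R (free_A k)"
  unfolding A_T_def free_A_def tprod_proj_tmat[symmetric]
  by (simp add: T_list_def rtt_tmat_proj_tmat T_at_proj_tmat comp_def del: upt_Suc)

lemma R_T_proj: "R_T R k = proj_tmat R (free_RT k)"
  unfolding R_T_def free_RT_def tprod_proj_tmat[symmetric]
  by (simp add: T_list_def rtt_tmat_proj_tmat T_at_proj_tmat comp_def del: upt_Suc)

lemma of_tmat_free_A: "of_tmat k (free_A k) = anti k k * word_prod free_T k"
  unfolding free_A_def of_tmat_tprod foldr_Cons o_apply foldr_all_T_at
    free_scalar.of_tmat_antisymmetrizer[OF hecke_free_R] ..

lemma of_tmat_free_RT: "of_tmat k (free_RT k) = chain k 1 k * word_prod free_T k"
proof -
  have "foldr (\<lambda>M N. of_tmat k M * N) (map (\<lambda>i. free_scalar.hom_tmat (R_at R i)) ls) Z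
      = foldr (\<lambda>l M. gen k l * M) ls Z" if "set ls \<subseteq> {1..<k}" for ls Z
    using that by (induction ls) (auto simp: gen_def free_scalar.of_tmat_R_at)
  then have "of_tmat k (free_RT k) = foldr (\<lambda>l M. gen k l * M) [1..<k] (word_prod free_T k)"
    unfolding free_RT_def of_tmat_tprod foldr_append o_apply foldr_all_T_at by simp
  also have "\<dots> = chain k 1 k * word_prod free_T k"
    unfolding chain_def by (simp add: homogeneous_unit_left flip: foldr_mult_right)
  finally show ?thesis .
qed

lemma ptrace_lower:
  "1 \<le> k \<Longrightarrow> ptrace ring_of_type_algebra 1 (k - 1) M [i] [j] = lower_tr k (of_tmat k M) i j"
  and ptrace_upper:
  "1 \<le> k \<Longrightarrow> ptrace ring_of_type_algebra 2 k M [i] [j] = upper_tr k (of_tmat k M) i j"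
  and ptrace_full: "ptrace ring_of_type_algebra 1 k M [] [] = full_tr k (of_tmat k M)"
  by (auto simp: ptrace_def lower_tr_def upper_tr_def full_tr_def intro!: sum.cong)

lemma lower_wedge_power_proj:
  "1 \<le> k \<Longrightarrow> lower_wedge_power q R k i j = rtt_proj R (lower_tr k (anti k k * word_prod free_T k) i j)"
  by (simp only: lower_wedge_power_def A_T_proj ptrace_proj_tmat ptrace_lower of_tmat_free_A)

lemma upper_wedge_power_proj:
  "1 \<le> k \<Longrightarrow> upper_wedge_power q R k i j = rtt_proj R (upper_tr k (anti k k * word_prod free_T k) i j)"
  by (simp only: upper_wedge_power_def A_T_proj ptrace_proj_tmat ptrace_upper of_tmat_free_A)

lemma lower_power_proj: "1 \<le> k \<Longrightarrow> lower_power R k i j = rtt_proj R (low k i j)"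
  by (simp only: lower_power_def R_T_proj ptrace_proj_tmat ptrace_lower of_tmat_free_RT low_def)

lemma upper_power_proj: "1 \<le> k \<Longrightarrow> upper_power R k i j = rtt_proj R (upp k i j)"
  by (simp only: upper_power_def R_T_proj ptrace_proj_tmat ptrace_upper of_tmat_free_RT upp_def)

lemma sigma_T_proj: "sigma_T q R m = rtt_proj R (sigma m)"
  unfolding sigma_T_def A_T_proj ptrace_proj_tmat
  by (simp add: sigma_def rtt_proj_one rtt_scalar_proj rtt_proj_mult
      ptrace_full[unfolded One_nat_def] of_tmat_free_A)

lemma cayley_hamilton_newton_lower:
  assumes "1 \<le> k"
  shows "rtt_scalar R (qnum q k) \<otimes>\<^bsub>rtt_algebra R\<^esub> lower_wedge_power q R k i j =
    \<ominus>\<^bsub>rtt_algebra R\<^esub> (\<Oplus>\<^bsub>rtt_algebra R\<^esub>m\<in>{0..k - 1}.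
      rtt_scalar R ((-1) ^ (k - m)) \<otimes>\<^bsub>rtt_algebra R\<^esub>
        (sigma_T q R m \<otimes>\<^bsub>rtt_algebra R\<^esub> lower_power R (k - m) i j))"
proof -
  interpret Q: ring "rtt_algebra R"
    using ring_hom_rtt_proj[of R] by (simp add: ring_hom_ring_def)
  have "(\<Oplus>\<^bsub>rtt_algebra R\<^esub>m\<in>{0..k - 1}. rtt_scalar R ((-1) ^ (k - m)) \<otimes>\<^bsub>rtt_algebra R\<^esub>
        (sigma_T q R m \<otimes>\<^bsub>rtt_algebra R\<^esub> lower_power R (k - m) i j))
      = (\<Oplus>\<^bsub>rtt_algebra R\<^esub>m\<in>{0..k - 1}.
          rtt_proj R (free_scalar ((-1) ^ (k - m)) * (sigma m * low (k - m) i j)))"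
    \<comment> \<open>The summation range gives \<open>1 \<le> k - m\<close>, so every power of
      \<open>T\<close> in the sum has a representative.\<close>
    using assms ring_hom_ring.homh[OF ring_hom_rtt_proj[of R]]
    by (intro Q.finsum_cong')
      (auto simp: sigma_T_proj lower_power_proj rtt_scalar_proj rtt_proj_mult dest: ring_hom_closed)
  then show ?thesis
    using rtt_proj_eqv[OF lower_newton[OF assms]] assms
    by (simp add: lower_wedge_power_proj rtt_scalar_proj rtt_proj_mult rtt_proj_sum rtt_proj_uminus)
qed

lemma cayley_hamilton_newton_upper:
  assumes "1 \<le> k"
  shows "rtt_scalar R (qnum q k) \<otimes>\<^bsub>rtt_algebra R\<^esub> upper_wedge_power q R k i j =
    \<ominus>\<^bsub>rtt_algebra R\<^esub> (\<Oplus>\<^bsub>rtt_algebra R\<^esub>m\<in>{0..k - 1}.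
      rtt_scalar R ((-1) ^ (k - m)) \<otimes>\<^bsub>rtt_algebra R\<^esub>
        (upper_power R (k - m) i j \<otimes>\<^bsub>rtt_algebra R\<^esub> sigma_T q R m))"
proof -
  interpret Q: ring "rtt_algebra R"
    using ring_hom_rtt_proj[of R] by (simp add: ring_hom_ring_def)
  have "(\<Oplus>\<^bsub>rtt_algebra R\<^esub>m\<in>{0..k - 1}. rtt_scalar R ((-1) ^ (k - m)) \<otimes>\<^bsub>rtt_algebra R\<^esub>
        (upper_power R (k - m) i j \<otimes>\<^bsub>rtt_algebra R\<^esub> sigma_T q R m))
      = (\<Oplus>\<^bsub>rtt_algebra R\<^esub>m\<in>{0..k - 1}.
          rtt_proj R (free_scalar ((-1) ^ (k - m)) * (upp (k - m) i j * sigma m)))"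
    using assms ring_hom_ring.homh[OF ring_hom_rtt_proj[of R]]
    by (intro Q.finsum_cong')
      (auto simp: sigma_T_proj upper_power_proj rtt_scalar_proj rtt_proj_mult dest: ring_hom_closed)
  then show ?thesis
    using rtt_proj_eqv[OF upper_newton[OF assms]] assms
    by (simp add: upper_wedge_power_proj rtt_scalar_proj rtt_proj_mult rtt_proj_sum rtt_proj_uminus)
qed

end

theorem mainTheorem3:
  fixes q :: "'k::field" and R :: "'k ^ ('n::finite \<times> 'n) ^ ('n \<times> 'n)" and k :: nat
  assumes "q \<noteq> 0"
    and "\<forall>m>0. q ^ m \<noteq> 1"
    and "yang_baxter R"
    and "hecke_type q R"
    and "k \<ge> 1"
  shows
    "(\<forall>i j. rtt_scalar R (qnum q k) \<otimes>\<^bsub>rtt_algebra R\<^esub> lower_wedge_power q R k i j =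
        \<ominus>\<^bsub>rtt_algebra R\<^esub> (\<Oplus>\<^bsub>rtt_algebra R\<^esub>m\<in>{0..k - 1}.
          rtt_scalar R ((-1) ^ (k - m)) \<otimes>\<^bsub>rtt_algebra R\<^esub>
            (sigma_T q R m \<otimes>\<^bsub>rtt_algebra R\<^esub> lower_power R (k - m) i j))) \<and>
     (\<forall>i j. rtt_scalar R (qnum q k) \<otimes>\<^bsub>rtt_algebra R\<^esub> upper_wedge_power q R k i j =
        \<ominus>\<^bsub>rtt_algebra R\<^esub> (\<Oplus>\<^bsub>rtt_algebra R\<^esub>m\<in>{0..k - 1}.
          rtt_scalar R ((-1) ^ (k - m)) \<otimes>\<^bsub>rtt_algebra R\<^esub>
            (upper_power R (k - m) i j \<otimes>\<^bsub>rtt_algebra R\<^esub> sigma_T q R m)))"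
proof -
  have "q_generic q" using assms(1,2) by unfold_locales
  note newton = cayley_hamilton_newton_lower[OF this assms(3-5)]
    cayley_hamilton_newton_upper[OF this assms(3-5)]
  show ?thesis by (intro conjI allI newton)
qed

end
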